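(* Let $M$ be a four-dimensional Riemann-Cartan space-time manifold with coordinates $(t,x,y,z)$, endowed with the Gödel-type metric $$ds^2=[dt+H(x)\,dy]^2-D^2(x)\,dy^2-dx^2-dz^2$$ and with the torsion whose only nonvanishing coordinate component (up to antisymmetry in the two lower indices) is $$T^t_{\ xy}=D(x)\,S(z),$$ where $H(x)$, $D(x)$, $S(z)$ are smooth real functions and $D$ is nowhere zero. Then $M$ is space-time locally homogeneous if and only if all three of the following functions are constant: $$\frac{H'}{D}=\text{const}\equiv 2\omega,\qquad \frac{D''}{D}=\text{const}\equiv m^2,\qquad S=\text{const}\equiv S_0 ,$$ where the prime denotes the derivative with respect to $x$.
   Context: A Riemann-Cartan space-time manifold is a smooth four-dimensional manifold with a Lorentzian metric $g$ and a metric-compatible, not necessarily symmetric, connection $\Gamma$. The connection is determined by $g$ and the torsion tensor $T$, which is antisymmetric in its two lower indices. The coordinates range over $t,y\in\mathbb{R}$ and $x,z$ in open intervals on which the functions are defined. Equivalently, in the coframe $\omega^0=dt+H(x)\,dy$, $\omega^1=dx$, $\omega^2=D(x)\,dy$, $\omega^3=dz$, the metric is $\eta_{AB}\omega^A\omega^B$ with $\eta=\mathrm{diag}(+1,-1,-1,-1)$, and the only nonvanishing torsion component (up to antisymmetry) is $T^0_{\ 12}=S(z)$; that is, $T=S(z)\,\partial_t\otimes(\omega^1\wedge\omega^2)$. An affine-isometric motion is a (local) diffeomorphism preserving both the metric and the connection (equivalently, the metric and the torsion). Infinitesimally, it is a vector field $X$ with $\mathcal{L}_Xg=0$ and $\mathcal{L}_XT=0$.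 $M$ is space-time homogeneous if the orbit of an arbitrary point under the group of affine-isometric motions is $M$ itself. It is locally homogeneous if this holds for the local action, i.e. the orbit of every point under local affine-isometric motions has dimension $4$. $m^2$ is the name of a real constant; no sign restriction is imposed on it. *)

theory Defs
  imports "HOL-Analysis.Analysis"
begin

primrec times_differentiable_on ::
  "nat \<Rightarrow> 'a::real_normed_vector set \<Rightarrow> ('a \<Rightarrow> 'b::real_normed_vector) \<Rightarrow> bool" where
  "times_differentiable_on 0 A f \<longleftrightarrow> continuous_on A f"
| "times_differentiable_on (Suc k) A f \<longleftrightarrow>
     (\<forall>x\<in>A. f differentiable (at x)) \<and>
     (\<forall>v. times_differentiable_on k A (\<lambda>x. frechet_derivative f (at x) v))"

text \<open>Only used on open sets of finite-dimensional spaces, where it is the usual notion of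
  \<open>C\<^sup>\<infinity>\<close>: all iterated directional derivatives exist and are continuous.\<close>

definition smooth_on ::
  "'a::real_normed_vector set \<Rightarrow> ('a \<Rightarrow> 'b::real_normed_vector) \<Rightarrow> bool" where
  "smooth_on A f \<longleftrightarrow> (\<forall>k. times_differentiable_on k A f)"

text \<open>A Riemann-Cartan structure on an open set of \<open>\<real>\<^sup>4\<close> (one coordinate chart) is given by its
  metric and its torsion, which determine the metric-compatible connection. Both are
  written invariantly: \<open>g p u v\<close> is \<open>g\<^sub>a\<^sub>b u\<^sup>a v\<^sup>b\<close> at \<open>p\<close> and \<open>T p u v\<close> is the vector with
  components \<open>T\<^sup>a\<^sub>b\<^sub>c u\<^sup>b v\<^sup>c\<close>.\<close>

type_synonym metric_field = "real^4 \<Rightarrow> real^4 \<Rightarrow> real^4 \<Rightarrow> real"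
type_synonym torsion_field = "real^4 \<Rightarrow> real^4 \<Rightarrow> real^4 \<Rightarrow> real^4"

definition local_diffeomorphism ::
  "(real^4) set \<Rightarrow> (real^4) set \<Rightarrow> (real^4 \<Rightarrow> real^4) \<Rightarrow> bool" where
  "local_diffeomorphism M U \<phi> \<longleftrightarrow>
     open U \<and> U \<subseteq> M \<and> open (\<phi> ` U) \<and> \<phi> ` U \<subseteq> M \<and> inj_on \<phi> U \<and>
     smooth_on U \<phi> \<and> smooth_on (\<phi> ` U) (inv_into U \<phi>)"

definition preserves_metric ::
  "metric_field \<Rightarrow> (real^4) set \<Rightarrow> (real^4 \<Rightarrow> real^4) \<Rightarrow> bool" where
  "preserves_metric g U \<phi> \<longleftrightarrow>
     (\<forall>p\<in>U. \<forall>u v. let d\<phi> = frechet_derivative \<phi> (at p) in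
        g (\<phi> p) (d\<phi> u) (d\<phi> v) = g p u v)"

definition preserves_torsion ::
  "torsion_field \<Rightarrow> (real^4) set \<Rightarrow> (real^4 \<Rightarrow> real^4) \<Rightarrow> bool" where
  "preserves_torsion T U \<phi> \<longleftrightarrow>
     (\<forall>p\<in>U. \<forall>u v. let d\<phi> = frechet_derivative \<phi> (at p) in
        T (\<phi> p) (d\<phi> u) (d\<phi> v) = d\<phi> (T p u v))"

definition affine_isometric_motion ::
  "(real^4) set \<Rightarrow> metric_field \<Rightarrow> torsion_field \<Rightarrow>
     (real^4) set \<Rightarrow> (real^4 \<Rightarrow> real^4) \<Rightarrow> bool" where
  "affine_isometric_motion M g T U \<phi> \<longleftrightarrow>
     local_diffeomorphism M U \<phi> \<and> preserves_metric g U \<phi> \<and> preserves_torsion T U \<phi>"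

definition local_orbit ::
  "(real^4) set \<Rightarrow> metric_field \<Rightarrow> torsion_field \<Rightarrow> real^4 \<Rightarrow> (real^4) set" where
  "local_orbit M g T p = {\<phi> p |\<phi> U. p \<in> U \<and> affine_isometric_motion M g T U \<phi>}"

text \<open>An orbit is a submanifold of the four-dimensional \<open>M\<close>; it has dimension four exactly when
  it is open. For connected \<open>M\<close>, all orbits being open means that every orbit is \<open>M\<close>, because
  the orbits partition \<open>M\<close>.\<close>

definition locally_homogeneous ::
  "(real^4) set \<Rightarrow> metric_field \<Rightarrow> torsion_field \<Rightarrow> bool" where
  "locally_homogeneous M g T \<longleftrightarrow> (\<forall>p\<in>M. open (local_orbit M g T p))"

text \<open>The coordinates \<open>(t, x, y, z)\<close> are the components \<open>1, 2, 3, 4\<close>.\<close>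

definition goedel_domain :: "real set \<Rightarrow> real set \<Rightarrow> (real^4) set" where
  "goedel_domain I J = {p. p $ 2 \<in> I \<and> p $ 4 \<in> J}"

definition goedel_metric :: "(real \<Rightarrow> real) \<Rightarrow> (real \<Rightarrow> real) \<Rightarrow> metric_field" where
  "goedel_metric H D p u v =
     (u $ 1 + H (p $ 2) * u $ 3) * (v $ 1 + H (p $ 2) * v $ 3)
     - (D (p $ 2))\<^sup>2 * u $ 3 * v $ 3 - u $ 2 * v $ 2 - u $ 4 * v $ 4"

definition goedel_torsion :: "(real \<Rightarrow> real) \<Rightarrow> (real \<Rightarrow> real) \<Rightarrow> torsion_field" where
  "goedel_torsion D S p u v =
     axis 1 (D (p $ 2) * S (p $ 4) * (u $ 2 * v $ 3 - u $ 3 * v $ 2))"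

end

theory Submission
  imports Defs
begin

text \<open>
  \<^emph>\<open>Homogeneity implies constancy.\<close> Motions preserve the square of \<open>S\<close>, being a norm of the torsion, and
  they intertwine the Ricci operators. With \<open>f = H'/D\<close> and \<open>\<kappa> = f\<^sup>2/2 - D''/D\<close> the Ricci operator has the
  eigenvector \<open>\<partial>\<^sub>x\<close> with eigenvalue \<open>-\<kappa>\<close> and the trace \<open>f\<^sup>2/2 - 2\<kappa>\<close>. Near a given point all points are
  images of it, so \<open>-\<kappa>\<close> takes values in the finite spectrum at that point; by continuity \<open>\<kappa>\<close> is locally
  constant, then so is \<open>f\<^sup>2\<close>, hence \<open>f\<close> and \<open>D''/D\<close>. This works for \<open>S = 0\<close> too, where the torsion
  singles out no direction.

  \<^emph>\<open>Constancy implies homogeneity.\<close> Then \<open>dx\<^sup>2 + D\<^sup>2 dy\<^sup>2\<close> has constant curvature \<open>k = -m\<^sup>2\<close> and the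
  \<open>1\<close>-form \<open>H dy\<close> has constant curl \<open>2\<omega>\<close> with respect to its area form. So near every point the structure
  is isometric to one fixed model around its origin, after a shift of \<open>t\<close> by a function of \<open>(x, y)\<close> that
  absorbs the difference of two primitives of the same \<open>2\<close>-form.
\<close>

section \<open>Calculus of smooth functions\<close>

text \<open>A motion may turn the direction of \<open>x\<close> into another one, so \<kappa> at a
  point cannot be identified with \<kappa> at its image. What survives is that -\<kappa> at the
  image lies in the spectrum at the point; finiteness of that spectrum and continuity replace any
  matching of eigenvectors. Only squares are available at first: an isometry such as t -> -t for
  \<open>H = 0\<close> reverses the torsion, so the data at a point fix \<open>S\<close> up to sign.
  Connectedness of the intervals then settles the sign. The curvature in question is that of the
  Levi-Civita connection of the metric. In the converse, the chart at \<open>p\<close> depends on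
  \<open>p\<close> through d = D(x0) and a = D'(x0)/d, but the model contains only k, \<omega> and
  S0. The model surface is realized as a quadric because this treats all signs of k at once: no
  formula of the chart divides by k or by k + a^2, the parameter of the rotations that enter
  it.\<close>

lemma times_differentiable_on_Suc_has_derivative:
  assumes "times_differentiable_on (Suc k) A f" "x \<in> A"
  shows "(f has_derivative frechet_derivative f (at x)) (at x)"
  using assms frechet_derivative_works by auto

lemma times_differentiable_on_continuous_on: "times_differentiable_on k A f \<Longrightarrow> continuous_on A f"
  by (cases k) (auto intro!: differentiable_imp_continuous_on
      simp: differentiable_on_def differentiable_at_withinI)

lemma times_differentiable_on_SucD: "times_differentiable_on (Suc k) A f \<Longrightarrow> times_differentiable_on k A f"
proof (induction k arbitrary: f)
  case 0
  then show ?case by (metis times_differentiable_on_continuous_on times_differentiable_on.simps(1))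
qed auto

lemma times_differentiable_on_subset: "times_differentiable_on k A f \<Longrightarrow> B \<subseteq> A \<Longrightarrow> times_differentiable_on k B f"
proof (induction k arbitrary: f)
  case 0
  then show ?case using continuous_on_subset by auto
qed auto

lemma times_differentiable_on_cong:
  assumes "open A" "times_differentiable_on k A f" "\<And>x. x \<in> A \<Longrightarrow> f x = g x"
  shows "times_differentiable_on k A g"
  using assms(2,3)
proof (induction k arbitrary: f g)
  case 0
  then show ?case using continuous_on_cong[of A A f g] by simp
next
  case (Suc k)
  have der: "(g has_derivative frechet_derivative f (at x)) (at x)" if "x \<in> A" for x
    using has_derivative_transform_within_open[OF times_differentiable_on_Suc_has_derivative[OF Suc.prems(1) that]]
      Suc.prems(2) assms(1) that by blast
  then have "frechet_derivative g (at x) = frechet_derivative f (at x)" if "x \<in> A" for x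
    using frechet_derivative_at that by metis
  then have "times_differentiable_on k A (\<lambda>x. frechet_derivative g (at x) v)" for v
    using Suc.IH[of "\<lambda>x. frechet_derivative f (at x) v"] Suc.prems(1) by simp
  then show ?case using der differentiableI by fastforce
qed

text \<open>Derivatives are unique, so any explicit formula \<open>f'\<close> may stand in for
  \<open>frechet_derivative\<close> in the recursive definition.\<close>

lemma times_differentiable_on_SucI:
  assumes "open A" "\<And>x. x \<in> A \<Longrightarrow> (f has_derivative f' x) (at x)"
    "\<And>v. times_differentiable_on k A (\<lambda>x. f' x v)"
  shows "times_differentiable_on (Suc k) A f"
proof -
  have "f' x = frechet_derivative f (at x)" if "x \<in> A" for x
    using frechet_derivative_at assms(2) that by blast
  then have "times_differentiable_on k A (\<lambda>x. frechet_derivative f (at x) v)" for v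
    using times_differentiable_on_cong[OF assms(1) assms(3)] by simp
  then show ?thesis using assms(2) differentiableI by fastforce
qed

lemma times_differentiable_on_const: "open A \<Longrightarrow> times_differentiable_on k A (\<lambda>x. c)"
proof (induction k arbitrary: c)
  case (Suc k)
  then show ?case by (intro times_differentiable_on_SucI[where f' = "\<lambda>_ _. 0"]) auto
qed auto

lemma times_differentiable_on_bounded_linear:
  assumes "open A" "bounded_linear L"
  shows "times_differentiable_on k A L"
proof (cases k)
  case 0
  then show ?thesis using assms(2) linear_continuous_on by auto
next
  case (Suc n)
  then show ?thesis using assms times_differentiable_on_const
    by (simp only:) (rule times_differentiable_on_SucI[where f' = "\<lambda>_. L"], auto intro: bounded_linear_imp_has_derivative)
qed

lemma times_differentiable_on_linear_compose:
  assumes "open A" "bounded_linear L" "times_differentiable_on k A f"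
  shows "times_differentiable_on k A (\<lambda>x. L (f x))"
  using assms(3)
proof (induction k arbitrary: f)
  case 0
  then show ?case using bounded_linear.continuous_on[OF assms(2)] by simp
next
  case (Suc k)
  show ?case
  proof (rule times_differentiable_on_SucI[OF assms(1)])
    show "((\<lambda>x. L (f x)) has_derivative (\<lambda>h. L (frechet_derivative f (at x) h))) (at x)"
      if "x \<in> A" for x
      using bounded_linear.has_derivative[OF assms(2) times_differentiable_on_Suc_has_derivative[OF Suc.prems that]] .
    show "times_differentiable_on k A (\<lambda>x. L (frechet_derivative f (at x) v))" for v
      using Suc by auto
  qed
qed

lemma times_differentiable_on_add:
  assumes "open A" "times_differentiable_on k A f" "times_differentiable_on k A g"
  shows "times_differentiable_on k A (\<lambda>x. f x + g x)"
  using assms(2,3)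
proof (induction k arbitrary: f g)
  case 0
  then show ?case by (auto intro: continuous_intros)
next
  case (Suc k)
  show ?case
  proof (rule times_differentiable_on_SucI[OF assms(1)])
    show "((\<lambda>x. f x + g x) has_derivative
       (\<lambda>h. frechet_derivative f (at x) h + frechet_derivative g (at x) h)) (at x)"
      if "x \<in> A" for x
      using times_differentiable_on_Suc_has_derivative[OF Suc.prems(1) that] times_differentiable_on_Suc_has_derivative[OF Suc.prems(2) that]
      by (intro has_derivative_add)
    show "times_differentiable_on k A
        (\<lambda>x. frechet_derivative f (at x) v + frechet_derivative g (at x) v)" for v
      using Suc by auto
  qed
qed

lemma times_differentiable_on_sum:
  assumes "open A" "finite B" "\<And>b. b \<in> B \<Longrightarrow> times_differentiable_on k A (f b)"
  shows "times_differentiable_on k A (\<lambda>x. \<Sum>b\<in>B. f b x)"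
  using assms(2,3) by (induction B rule: finite_induct) (simp_all add: times_differentiable_on_add times_differentiable_on_const assms(1))

lemma times_differentiable_on_bilinear:
  assumes "open A" "bounded_bilinear B" "times_differentiable_on k A f" "times_differentiable_on k A g"
  shows "times_differentiable_on k A (\<lambda>x. B (f x) (g x))"
  using assms(3,4)
proof (induction k arbitrary: f g)
  case 0
  then show ?case using bounded_bilinear.continuous_on[OF assms(2)] by auto
next
  case (Suc k)
  show ?case
  proof (rule times_differentiable_on_SucI[OF assms(1)])
    show "((\<lambda>x. B (f x) (g x)) has_derivative
       (\<lambda>h. B (f x) (frechet_derivative g (at x) h) + B (frechet_derivative f (at x) h) (g x))) (at x)"
      if "x \<in> A" for x
      using times_differentiable_on_Suc_has_derivative[OF Suc.prems(1) that] times_differentiable_on_Suc_has_derivative[OF Suc.prems(2) that]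
      by (intro bounded_bilinear.FDERIV[OF assms(2)])
    show "times_differentiable_on k A (\<lambda>x. B (f x) (frechet_derivative g (at x) v)
        + B (frechet_derivative f (at x) v) (g x))" for v
      using Suc.prems times_differentiable_on_SucD[OF Suc.prems(1)] times_differentiable_on_SucD[OF Suc.prems(2)]
      by (intro times_differentiable_on_add[OF assms(1)] Suc.IH) simp_all
  qed
qed

lemma linear_basis_expansion:
  fixes L :: "'a::euclidean_space \<Rightarrow> 'b::real_vector"
  assumes "linear L"
  shows "L v = (\<Sum>b\<in>Basis. (v \<bullet> b) *\<^sub>R L b)"
proof -
  have "L v = L (\<Sum>b\<in>Basis. (v \<bullet> b) *\<^sub>R b)"
    by (simp only: euclidean_representation)
  also have "\<dots> = (\<Sum>b\<in>Basis. (v \<bullet> b) *\<^sub>R L b)"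
    by (simp only: linear_sum[OF assms] linear_cmul[OF assms])
  finally show ?thesis .
qed

text \<open>In the chain rule the direction in which \<open>f\<close> is differentiated varies with
  the point, whereas the definition speaks of fixed directions only. Expanding that direction in
  \<open>Basis\<close> yields a sum of products to which the induction hypothesis applies.\<close>

lemma times_differentiable_on_compose:
  fixes g :: "'a::real_normed_vector \<Rightarrow> 'b::euclidean_space" and f :: "'b \<Rightarrow> 'c::real_normed_vector"
  assumes "open A" "times_differentiable_on k B f" "times_differentiable_on k A g" "g ` A \<subseteq> B"
  shows "times_differentiable_on k A (\<lambda>x. f (g x))"
  using assms(2,3)
proof (induction k arbitrary: f)
  case 0
  then show ?case using continuous_on_compose2[of B f A g] assms(4) by simp
next
  case (Suc k)
  show ?case
  proof (rule times_differentiable_on_SucI[OF assms(1)])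
    fix x assume x: "x \<in> A"
    then have f: "(f has_derivative frechet_derivative f (at (g x))) (at (g x))"
      using assms(4) by (intro times_differentiable_on_Suc_has_derivative[OF Suc.prems(1)]) auto
    have "((\<lambda>x. f (g x)) has_derivative
        (\<lambda>h. frechet_derivative f (at (g x)) (frechet_derivative g (at x) h))) (at x)"
      using has_derivative_compose[OF times_differentiable_on_Suc_has_derivative[OF Suc.prems(2) x] f] .
    then show "((\<lambda>x. f (g x)) has_derivative
      (\<lambda>h. \<Sum>b\<in>Basis. (frechet_derivative g (at x) h \<bullet> b) *\<^sub>R frechet_derivative f (at (g x)) b)) (at x)"
      by (rule has_derivative_eq_rhs)
        (rule ext, rule linear_basis_expansion[OF has_derivative_linear[OF f]])
  next
    fix v
    have "times_differentiable_on k A (\<lambda>x. frechet_derivative g (at x) v \<bullet> b)" for b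
      using Suc.prems(2) by (intro times_differentiable_on_linear_compose[OF assms(1) bounded_linear_inner_left]) simp
    moreover have "times_differentiable_on k A (\<lambda>x. frechet_derivative f (at (g x)) b)" for b
      using Suc.IH[of "\<lambda>y. frechet_derivative f (at y) b"] Suc.prems(1) times_differentiable_on_SucD[OF Suc.prems(2)]
      by simp
    ultimately show "times_differentiable_on k A (\<lambda>x. \<Sum>b\<in>Basis.
        (frechet_derivative g (at x) v \<bullet> b) *\<^sub>R frechet_derivative f (at (g x)) b)"
      by (intro times_differentiable_on_sum[OF assms(1) finite_Basis] times_differentiable_on_bilinear[OF assms(1) bounded_bilinear_scaleR])
  qed
qed

lemma times_differentiable_on_vec:
  fixes f :: "'a::real_normed_vector \<Rightarrow> real^'n"
  assumes "open A" "\<And>i. times_differentiable_on k A (\<lambda>x. f x $ i)"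
  shows "times_differentiable_on k A f"
proof -
  have "times_differentiable_on k A (\<lambda>x. \<Sum>i\<in>UNIV. f x $ i *\<^sub>R axis i (1::real))"
    by (intro times_differentiable_on_sum times_differentiable_on_bilinear[OF _ bounded_bilinear_scaleR] times_differentiable_on_const assms) auto
  moreover have "(\<Sum>i\<in>UNIV. f x $ i *\<^sub>R axis i (1::real)) = f x" for x
    by (simp add: vec_eq_iff axis_def if_distrib cong: if_cong)
  ultimately show ?thesis by simp
qed

text \<open>The derivative is a polynomial in \<open>inverse\<close> itself, so order
  \<open>k\<close> gives order \<open>Suc k\<close>.\<close>

lemma times_differentiable_on_inverse:
  fixes A :: "real set"
  assumes "open A" "0 \<notin> A"
  shows "times_differentiable_on k A inverse"
proof (induction k)
  case 0
  then show ?case using assms by (auto intro!: continuous_intros)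
next
  case (Suc k)
  show ?case
  proof (rule times_differentiable_on_SucI[OF assms(1)])
    show "(inverse has_derivative (\<lambda>h. - (inverse x * h * inverse x))) (at x)" if "x \<in> A" for x
      using has_derivative_inverse'[of x] assms(2) that by metis
    have "times_differentiable_on k A (\<lambda>x. (inverse x * inverse x) * - v)" for v
      by (rule times_differentiable_on_bilinear[OF assms(1) bounded_bilinear_mult times_differentiable_on_bilinear[OF assms(1) bounded_bilinear_mult Suc Suc]
            times_differentiable_on_const[OF assms(1)]])
    then show "times_differentiable_on k A (\<lambda>x. - (inverse x * v * inverse x))" for v
      by (simp add: algebra_simps)
  qed
qed

section \<open>Closure properties of smooth functions\<close>

lemma smooth_on_has_derivative:
  "smooth_on A f \<Longrightarrow> x \<in> A \<Longrightarrow> (f has_derivative frechet_derivative f (at x)) (at x)"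
  unfolding smooth_on_def using times_differentiable_on_Suc_has_derivative by blast

lemma smooth_on_frechet: "smooth_on A f \<Longrightarrow> smooth_on A (\<lambda>x. frechet_derivative f (at x) v)"
  unfolding smooth_on_def by (metis times_differentiable_on.simps(2))

lemma smooth_on_continuous_on: "smooth_on A f \<Longrightarrow> continuous_on A f"
  unfolding smooth_on_def using times_differentiable_on_continuous_on by blast

lemma smooth_on_subset: "smooth_on A f \<Longrightarrow> B \<subseteq> A \<Longrightarrow> smooth_on B f"
  unfolding smooth_on_def using times_differentiable_on_subset by blast

lemma smooth_on_cong: "open A \<Longrightarrow> smooth_on A f \<Longrightarrow> (\<And>x. x \<in> A \<Longrightarrow> f x = g x) \<Longrightarrow> smooth_on A g"
  unfolding smooth_on_def using times_differentiable_on_cong by metis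

text \<open>A class of functions closed under directional derivatives consists of smooth functions.
  This serves functions known only through a linear system of differential equations.\<close>

lemma smooth_on_coinduct:
  assumes "open A" "\<And>f. P f \<Longrightarrow> \<exists>f'. (\<forall>x\<in>A. (f has_derivative f' x) (at x)) \<and> (\<forall>v. P (\<lambda>x. f' x v))" "P f"
  shows "smooth_on A f"
proof -
  have "times_differentiable_on k A f" for k
    using assms(3)
  proof (induction k arbitrary: f)
    case 0
    obtain f' where "\<forall>x\<in>A. (f has_derivative f' x) (at x)"
      using assms(2)[OF 0] by blast
    then have "continuous (at x) f" if "x \<in> A" for x
      using has_derivative_continuous that by blast
    then show ?case by (simp add: continuous_at_imp_continuous_on)
  next
    case (Suc k)
    obtain f' where f': "\<forall>x\<in>A. (f has_derivative f' x) (at x)" "\<forall>v. P (\<lambda>x. f' x v)"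
      using assms(2)[OF Suc.prems] by blast
    show ?case using f' Suc.IH by (intro times_differentiable_on_SucI[OF assms(1), of f f']) auto
  qed
  then show ?thesis unfolding smooth_on_def by blast
qed

lemma smooth_on_derivativeI:
  assumes "open A" "\<And>x. x \<in> A \<Longrightarrow> (f has_derivative f' x) (at x)" "\<And>v. smooth_on A (\<lambda>x. f' x v)"
  shows "smooth_on A f"
proof -
  have "times_differentiable_on (Suc k) A f" for k
    using times_differentiable_on_SucI[OF assms(1,2)] assms(3) smooth_on_def by blast
  then show ?thesis unfolding smooth_on_def using times_differentiable_on_SucD by blast
qed

lemma smooth_on_const: "open A \<Longrightarrow> smooth_on A (\<lambda>x. c)"
  unfolding smooth_on_def using times_differentiable_on_const by blast

lemma smooth_on_bounded_linear: "open A \<Longrightarrow> bounded_linear L \<Longrightarrow> smooth_on A L"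
  unfolding smooth_on_def using times_differentiable_on_bounded_linear by blast

lemma smooth_on_add: "open A \<Longrightarrow> smooth_on A f \<Longrightarrow> smooth_on A g \<Longrightarrow> smooth_on A (\<lambda>x. f x + g x)"
  unfolding smooth_on_def using times_differentiable_on_add by blast

lemma smooth_on_uminus: "open A \<Longrightarrow> smooth_on A f \<Longrightarrow> smooth_on A (\<lambda>x. - f x)"
  unfolding smooth_on_def
  using times_differentiable_on_linear_compose[OF _ bounded_linear_minus[OF bounded_linear_ident]] by blast

lemma smooth_on_diff: "open A \<Longrightarrow> smooth_on A f \<Longrightarrow> smooth_on A g \<Longrightarrow> smooth_on A (\<lambda>x. f x - g x)"
  using smooth_on_add[OF _ _ smooth_on_uminus, of A f g] by simp

lemma smooth_on_mult:
  fixes f g :: "'a::real_normed_vector \<Rightarrow> real"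
  shows "open A \<Longrightarrow> smooth_on A f \<Longrightarrow> smooth_on A g \<Longrightarrow> smooth_on A (\<lambda>x. f x * g x)"
  unfolding smooth_on_def using times_differentiable_on_bilinear[OF _ bounded_bilinear_mult] by blast

lemma smooth_on_compose:
  fixes g :: "'a::real_normed_vector \<Rightarrow> 'b::euclidean_space" and f :: "'b \<Rightarrow> 'c::real_normed_vector"
  shows "open A \<Longrightarrow> smooth_on B f \<Longrightarrow> smooth_on A g \<Longrightarrow> g ` A \<subseteq> B \<Longrightarrow> smooth_on A (\<lambda>x. f (g x))"
  unfolding smooth_on_def using times_differentiable_on_compose by blast

lemma smooth_on_divide:
  fixes f g :: "'a::real_normed_vector \<Rightarrow> real"
  assumes "open A" "smooth_on A f" "smooth_on A g" "\<And>x. x \<in> A \<Longrightarrow> g x \<noteq> 0"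
  shows "smooth_on A (\<lambda>x. f x / g x)"
proof -
  have "smooth_on (- {0}) (inverse :: real \<Rightarrow> real)"
    unfolding smooth_on_def by (intro allI times_differentiable_on_inverse) auto
  then have "smooth_on A (\<lambda>x. inverse (g x))"
    by (rule smooth_on_compose[OF assms(1) _ assms(3)]) (use assms(4) in auto)
  then show ?thesis using smooth_on_mult[OF assms(1,2)] by (simp add: divide_inverse)
qed

lemma smooth_on_vec:
  fixes f :: "'a::real_normed_vector \<Rightarrow> real^'n"
  shows "open A \<Longrightarrow> (\<And>i. smooth_on A (\<lambda>x. f x $ i)) \<Longrightarrow> smooth_on A f"
  unfolding smooth_on_def using times_differentiable_on_vec by blast

text \<open>The inverse is as smooth as the map: \<open>D g = B \<circ> g\<close> expresses the derivative of the inverse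
  \<open>g\<close> through \<open>g\<close> itself, so one more derivative of \<open>g\<close> exists than was assumed.\<close>
lemma smooth_on_inverse:
  fixes g :: "'a::real_normed_vector \<Rightarrow> 'b::euclidean_space"
  assumes "open V" "g ` V \<subseteq> U" "\<And>y. y \<in> V \<Longrightarrow> (g has_derivative B (g y)) (at y)"
    "\<And>v. smooth_on U (\<lambda>p. B p v)"
  shows "smooth_on V g"
proof -
  have "times_differentiable_on k V g" for k
  proof (induction k)
    case 0
    have "continuous (at y) g" if "y \<in> V" for y
      using has_derivative_continuous assms(3)[OF that] by blast
    then show ?case by (simp add: continuous_at_imp_continuous_on)
  next
    case (Suc k)
    have "times_differentiable_on k V (\<lambda>y. B (g y) v)" for v
      using assms(4) unfolding smooth_on_def by (intro times_differentiable_on_compose[OF assms(1) _ Suc assms(2)]) simp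
    then show ?case by (intro times_differentiable_on_SucI[OF assms(1,3)])
  qed
  then show ?thesis unfolding smooth_on_def by blast
qed

section \<open>Charts with a common local model\<close>

text \<open>The inverse function theorem yields a differentiable inverse \<open>G\<close> only. An
  explicit inverse \<open>B\<close> of the differential that is smooth in the base point turns its
  derivative formula into D G = B o G, the situation of \<open>smooth_on_inverse\<close>. A left
  inverse is enough, since the dimension is finite.\<close>

lemma smooth_local_inverse:
  fixes F :: "'a::euclidean_space \<Rightarrow> 'a"
  assumes "open U" "p \<in> U" and F: "smooth_on U F" and B: "\<And>v. smooth_on U (\<lambda>q. B q v)"
    and left_inv: "\<And>q v. q \<in> U \<Longrightarrow> B q (frechet_derivative F (at q) v) = v"
  obtains U' where "open U'" "U' \<subseteq> U" "p \<in> U'" "open (F ` U')" "inj_on F U'"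
    "smooth_on (F ` U') (inv_into U' F)"
proof -
  let ?F' = "\<lambda>q. frechet_derivative F (at q)"
  have F': "(F has_derivative ?F' q) (at q)" if "q \<in> U" for q
    using F that by (rule smooth_on_has_derivative)
  define f' where "f' q = Blinfun (?F' q)" for q
  have f': "blinfun_apply (f' q) = ?F' q" if "q \<in> U" for q
    unfolding f'_def using F'[OF that]
    by (intro bounded_linear_Blinfun_apply has_derivative_bounded_linear)
  have bij: "bij (?F' q)" and B_eq: "B q = inv (?F' q)" if q: "q \<in> U" for q
  proof -
    have inj: "inj (?F' q)" using left_inv[OF q] by (metis injI)
    then have surj: "surj (?F' q)"
      using linear_injective_imp_surjective has_derivative_linear[OF F'[OF q]] by blast
    show "bij (?F' q)" using inj surj by (simp add: bij_def)
    show "B q = inv (?F' q)"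
      using left_inv[OF q] surj inj by (intro ext) (metis inv_f_f surj_f_inv_f)
  qed
  have lin: "bounded_linear (B p)"
    using linear_injective_left_inverse has_derivative_linear[OF F'[OF assms(2)]] bij[OF assms(2)]
      B_eq[OF assms(2)]
    by (metis bij_is_inj bij_is_surj linear_conv_bounded_linear inj_linear_imp_inv_linear)
  obtain U' V G G' where U': "open U'" "U' \<subseteq> U" "p \<in> U'" "open V" and hom: "homeomorphism U' V F G"
    and G': "\<And>y. y \<in> V \<Longrightarrow> (G has_derivative (G' y)) (at y)"
      "\<And>y. y \<in> V \<Longrightarrow> G' y = inv (blinfun_apply (f' (G y)))"
  proof (rule inverse_function_theorem[of U F f' p "Blinfun (B p)"])
    show "(F has_derivative blinfun_apply (f' x)) (at x)" if "x \<in> U" for x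
      using F'[OF that] f'[OF that] by simp
    show "continuous_on U f'"
    proof (rule continuous_on_blinfun_componentwise)
      fix i :: 'a
      have "continuous_on U (\<lambda>x. ?F' x i)"
        using smooth_on_continuous_on smooth_on_frechet F by blast
      then show "continuous_on U (\<lambda>x. blinfun_apply (f' x) i)"
        using f' by (simp cong: continuous_on_cong_simp)
    qed
    show "Blinfun (B p) o\<^sub>L f' p = id_blinfun"
      using f' assms(2) left_inv lin by (intro blinfun_eqI) (simp add: bounded_linear_Blinfun_apply)
  qed (use assms(1,2) in auto)
  have im: "F ` U' = V" "G ` V = U'" and GF: "\<And>x. x \<in> U' \<Longrightarrow> G (F x) = x"
    using hom by (auto simp: homeomorphism_def)
  have inj: "inj_on F U'" using GF by (metis inj_onI)
  have "(G has_derivative B (G y)) (at y)" if "y \<in> V" for y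
    using G'(1)[OF that] G'(2)[OF that] that im U' B_eq f' by (metis image_eqI subsetD)
  then have "smooth_on V G"
    using U' im B by (intro smooth_on_inverse[of V G U B]) auto
  moreover have "G y = inv_into U' F y" if "y \<in> V" for y
    using that im GF inj by (metis f_inv_into_f inv_into_into)
  ultimately have "smooth_on (F ` U') (inv_into U' F)"
    using smooth_on_cong U'(4) im by metis
  then show ?thesis using that U' im inj by metis
qed

text \<open>Charts in which the structure takes the same shape \<open>g\<^sub>s, T\<^sub>s\<close> near every point: the transition
  from a chart at \<open>p\<close> to one at \<open>q\<close> is a motion carrying \<open>p\<close> to \<open>q\<close>, so no group of motions of the
  model has to be known.\<close>
definition standard_chart :: "(real^4) set \<Rightarrow> metric_field \<Rightarrow> torsion_field \<Rightarrow> metric_field \<Rightarrow> torsion_field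
    \<Rightarrow> real^4 \<Rightarrow> (real^4) set \<Rightarrow> (real^4 \<Rightarrow> real^4) \<Rightarrow> bool" where
  "standard_chart M g T g\<^sub>s T\<^sub>s p U F \<longleftrightarrow>
     open U \<and> p \<in> U \<and> U \<subseteq> M \<and> F p = 0 \<and> smooth_on U F \<and>
     inj_on F U \<and> open (F ` U) \<and> smooth_on (F ` U) (inv_into U F) \<and>
     (\<forall>q\<in>U. \<forall>u v. let dF = frechet_derivative F (at q) in
        g\<^sub>s (F q) (dF u) (dF v) = g q u v \<and> T\<^sub>s (F q) (dF u) (dF v) = dF (T q u v))"

text \<open>The motion is E^-1 o F on the part of \<open>U\<close> that \<open>F\<close> sends into
  the overlap \<open>W\<close> of the two images. Both charts are centred at 0, so \<open>W\<close>
  is a neighbourhood of 0 and \<open>p\<close> is carried to \<open>q\<close>.\<close>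

lemma standard_chart_transition:
  assumes P: "standard_chart M g T g\<^sub>s T\<^sub>s p U F" and Q: "standard_chart M g T g\<^sub>s T\<^sub>s q V E"
  shows "q \<in> local_orbit M g T p"
proof -
  have U: "open U" "p \<in> U" "U \<subseteq> M" "F p = 0" "smooth_on U F" "inj_on F U" "smooth_on (F ` U) (inv_into U F)"
      "open (F ` U)"
    and U_iso: "\<And>x u v. x \<in> U \<Longrightarrow> g\<^sub>s (F x) (frechet_derivative F (at x) u) (frechet_derivative F (at x) v) = g x u v"
      "\<And>x u v. x \<in> U \<Longrightarrow> T\<^sub>s (F x) (frechet_derivative F (at x) u) (frechet_derivative F (at x) v)
        = frechet_derivative F (at x) (T x u v)"
    using P unfolding standard_chart_def Let_def by simp_all
  have V: "open V" "q \<in> V" "V \<subseteq> M" "E q = 0" "smooth_on V E" "inj_on E V" "smooth_on (E ` V) (inv_into V E)"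
      "open (E ` V)"
    and V_iso: "\<And>x u v. x \<in> V \<Longrightarrow> g\<^sub>s (E x) (frechet_derivative E (at x) u) (frechet_derivative E (at x) v) = g x u v"
      "\<And>x u v. x \<in> V \<Longrightarrow> T\<^sub>s (E x) (frechet_derivative E (at x) u) (frechet_derivative E (at x) v)
        = frechet_derivative E (at x) (T x u v)"
    using Q unfolding standard_chart_def Let_def by simp_all
  define W where "W = F ` U \<inter> E ` V"
  define U' where "U' = U \<inter> F -` W"
  define V' where "V' = V \<inter> E -` W"
  define \<phi> where "\<phi> = (\<lambda>x. inv_into V E (F x))"
  have W: "open W" "0 \<in> W"
    using U(2,4,8) V(2,4,8) unfolding W_def by (auto simp: image_iff intro: bexI[of _ p] bexI[of _ q])
  have U'_iff: "x \<in> U' \<longleftrightarrow> x \<in> U \<and> F x \<in> W" for x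
    by (simp add: U'_def)
  have V'_iff: "x \<in> V' \<longleftrightarrow> x \<in> V \<and> E x \<in> W" for x
    by (simp add: V'_def)
  have op: "open U'" "open V'"
    unfolding U'_def V'_def using W U(1,5) V(1,5) smooth_on_continuous_on
    by (auto intro: continuous_open_preimage)
  have E\<phi>: "E (\<phi> x) = F x" if "x \<in> U'" for x
    using that U'_iff by (simp add: \<phi>_def W_def f_inv_into_f)
  have \<phi>V: "\<phi> x \<in> V'" if "x \<in> U'" for x
    using that U'_iff E\<phi>[OF that] V'_iff by (auto simp: \<phi>_def W_def inv_into_into)
  have F\<psi>: "F (inv_into U F (E y)) = E y" "inv_into U F (E y) \<in> U'" if "y \<in> V'" for y
    using that V'_iff U'_iff by (auto simp: W_def f_inv_into_f inv_into_into)
  have \<phi>\<psi>: "\<phi> (inv_into U F (E y)) = y" if "y \<in> V'" for y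
    using F\<psi>[OF that] that V'_iff V(6) by (simp add: \<phi>_def)
  have im: "\<phi> ` U' = V'"
  proof
    show "\<phi> ` U' \<subseteq> V'" using \<phi>V by blast
    show "V' \<subseteq> \<phi> ` U'" using \<phi>\<psi> F\<psi>(2) by (metis image_eqI subsetI)
  qed
  have inj: "inj_on \<phi> U'"
  proof (rule inj_onI)
    fix x y assume "x \<in> U'" "y \<in> U'" "\<phi> x = \<phi> y"
    then show "x = y" using E\<phi>[of x] E\<phi>[of y] U'_iff inj_onD[OF U(6)] by simp
  qed
  have inv: "inv_into U F (E y) = inv_into U' \<phi> y" if "y \<in> V'" for y
    using \<phi>\<psi>[OF that] F\<psi>(2)[OF that] inj by (metis inv_into_f_f)
  have smooth: "smooth_on U' \<phi>"
    unfolding \<phi>_def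
    by (rule smooth_on_compose[OF op(1) V(7) smooth_on_subset[OF U(5)]])
      (use U'_iff in \<open>auto simp: W_def\<close>)
  have "smooth_on V' (\<lambda>y. inv_into U F (E y))"
    by (rule smooth_on_compose[OF op(2) U(7) smooth_on_subset[OF V(5)]])
      (use V'_iff in \<open>auto simp: W_def\<close>)
  from smooth_on_cong[OF op(2) this inv] have smooth': "smooth_on (\<phi> ` U') (inv_into U' \<phi>)"
    using im by simp
  have ld: "local_diffeomorphism M U' \<phi>"
    unfolding local_diffeomorphism_def using op im inj smooth smooth' U(3) V(3)
    by (auto simp: U'_def V'_def)
  let ?d = "\<lambda>f x. frechet_derivative f (at x)"
  have chain: "?d E (\<phi> x) (?d \<phi> x u) = ?d F x u" if x: "x \<in> U'" for x u
  proof -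
    have d\<phi>: "(\<phi> has_derivative ?d \<phi> x) (at x)"
      using smooth_on_has_derivative[OF smooth x] .
    have dE: "(E has_derivative ?d E (\<phi> x)) (at (\<phi> x))"
      using \<phi>V[OF x] V'_iff V(5) by (intro smooth_on_has_derivative) auto
    have "((\<lambda>x. E (\<phi> x)) has_derivative (\<lambda>u. ?d E (\<phi> x) (?d \<phi> x u))) (at x)"
      using has_derivative_compose[OF d\<phi> dE] .
    then have "(F has_derivative (\<lambda>u. ?d E (\<phi> x) (?d \<phi> x u))) (at x)"
      using E\<phi> by (rule has_derivative_transform_within_open[OF _ op(1) x])
    from frechet_derivative_at[OF this] show ?thesis by metis
  qed
  \<comment> \<open>Torsion is vector-valued: its invariance is first obtained with dE applied to
    both sides, and injectivity of dE removes it.\<close>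
  have injE: "inj (?d E y)" if y: "y \<in> V'" for y
  proof -
    have dE: "(E has_derivative ?d E y) (at y)"
      using y V'_iff V(5) by (intro smooth_on_has_derivative) auto
    have "(inv_into V E has_derivative ?d (inv_into V E) (E y)) (at (E y))"
      using y V'_iff V(7) by (intro smooth_on_has_derivative) auto
    from has_derivative_compose[OF dE this]
    have "((\<lambda>x. inv_into V E (E x)) has_derivative (\<lambda>u. ?d (inv_into V E) (E y) (?d E y u))) (at y)" .
    then have "((\<lambda>x. x) has_derivative (\<lambda>u. ?d (inv_into V E) (E y) (?d E y u))) (at y)"
      by (rule has_derivative_transform_within_open[OF _ op(2) y]) (use V'_iff V(6) in auto)
    then have "(\<lambda>u. ?d (inv_into V E) (E y) (?d E y u)) = (\<lambda>u. u)"
      using has_derivative_unique has_derivative_ident by blast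
    then show ?thesis by (metis injI)
  qed
  have "preserves_metric g U' \<phi>"
    unfolding preserves_metric_def Let_def
  proof safe
    fix x u v assume x: "x \<in> U'"
    have "g (\<phi> x) (?d \<phi> x u) (?d \<phi> x v) = g\<^sub>s (E (\<phi> x)) (?d E (\<phi> x) (?d \<phi> x u)) (?d E (\<phi> x) (?d \<phi> x v))"
      using V_iso \<phi>V[OF x] V'_iff by simp
    also have "\<dots> = g x u v" using U_iso x U'_iff by (simp add: chain E\<phi>)
    finally show "g (\<phi> x) (?d \<phi> x u) (?d \<phi> x v) = g x u v" .
  qed
  moreover have "preserves_torsion T U' \<phi>"
    unfolding preserves_torsion_def Let_def
  proof safe
    fix x u v assume x: "x \<in> U'"
    have "?d E (\<phi> x) (T (\<phi> x) (?d \<phi> x u) (?d \<phi> x v))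
        = T\<^sub>s (E (\<phi> x)) (?d E (\<phi> x) (?d \<phi> x u)) (?d E (\<phi> x) (?d \<phi> x v))"
      using V_iso \<phi>V[OF x] V'_iff by simp
    also have "\<dots> = ?d E (\<phi> x) (?d \<phi> x (T x u v))" using U_iso x U'_iff by (simp add: chain E\<phi>)
    finally show "T (\<phi> x) (?d \<phi> x u) (?d \<phi> x v) = ?d \<phi> x (T x u v)"
      using injE[OF \<phi>V[OF x]] by (simp add: inj_eq)
  qed
  moreover have "p \<in> U'" using U'_iff U(2,4) W by simp
  moreover have "\<phi> p = q" using U(4) V(2,4,6) unfolding \<phi>_def by (metis inv_into_f_f)
  ultimately show ?thesis
    using ld unfolding local_orbit_def affine_isometric_motion_def by blast
qed

lemma locally_homogeneous_if_standard_charts: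
  assumes "open M" "\<And>p. p \<in> M \<Longrightarrow> \<exists>U F. standard_chart M g T g\<^sub>s T\<^sub>s p U F"
  shows "locally_homogeneous M g T"
proof -
  have "local_orbit M g T p = M" if p: "p \<in> M" for p
  proof
    show "local_orbit M g T p \<subseteq> M"
      unfolding local_orbit_def affine_isometric_motion_def local_diffeomorphism_def by blast
    show "M \<subseteq> local_orbit M g T p"
    proof
      fix q assume "q \<in> M"
      then show "q \<in> local_orbit M g T p"
        using assms(2)[OF p] assms(2)[of q] standard_chart_transition by metis
    qed
  qed
  then show ?thesis using assms(1) unfolding locally_homogeneous_def by simp
qed

section \<open>Charts of a Goedel-type structure\<close>

text \<open>Here \<open>C\<close>, \<open>S\<close> are the generalized cosine and sine along a
  geodesic, and \<open>c\<close>, \<open>s\<close>, \<open>e\<close> those of the rotations with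
  parameter k + a^2. With \<xi> = S - a e N and \<eta> = s N, the conclusions say in turn: the point
  (z, \<xi>, \<eta>) lies on the quadric; the two components of \<xi> d\<eta> - \<eta> d\<xi>; those
  of \<xi> d\<xi> + \<eta> d\<eta>; the induced metric is dx^2 + N^2 dy^2; the Jacobian is z N; and
  the curl of (\<xi> d\<eta> - \<eta> d\<xi>)/(1 + z) is the area form. All are polynomial
  consequences of the hypotheses.\<close>

lemma chart_identities:
  fixes a k C S c s e N N' z :: real
  assumes CS: "C\<^sup>2 + k * S\<^sup>2 = 1" and c: "c = 1 - (k + a\<^sup>2) * e" and s: "s\<^sup>2 = e * (1 + c)"
    and N: "N = C + a * S" and N': "N' = a * C - k * S" and z: "z = C - k * e * N"
  shows "z\<^sup>2 = 1 - k * ((S - a * e * N)\<^sup>2 + (s * N)\<^sup>2)"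
    and "(S - a * e * N) * (s * N') - (s * N) * (C - a * e * N') = - s"
    and "(S - a * e * N) * (c * N) - (s * N) * (- a * s * N) = N * (c * S + a * e * N)"
    and "(S - a * e * N) * (C - a * e * N') + (s * N) * (s * N') = z * (S + e * N')"
    and "(S - a * e * N) * (- a * s * N) + (s * N) * (c * N) = z * (s * N)"
    and "(C - a * e * N')\<^sup>2 + (s * N')\<^sup>2 + k * (S + e * N')\<^sup>2 = 1"
    and "(C - a * e * N') * (- a * s * N) + (s * N') * (c * N) + k * (S + e * N') * (s * N) = 0"
    and "(- a * s * N)\<^sup>2 + (c * N)\<^sup>2 + k * (s * N)\<^sup>2 = N\<^sup>2"
    and "(C - a * e * N') * (c * N) - (- a * s * N) * (s * N') = z * N"
    and "N * (1 + z)\<^sup>2 - (N' * (c * S + a * e * N) + N * (c * C + a * e * N')) * (1 + z)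
        + N * (c * S + a * e * N) * (- k * (S + e * N')) = c * (1 + z) + k * s\<^sup>2 * N"
proof -
  note eqs = CS c s N N' z
  show "z\<^sup>2 = 1 - k * ((S - a * e * N)\<^sup>2 + (s * N)\<^sup>2)" using eqs by algebra
  show "(S - a * e * N) * (s * N') - (s * N) * (C - a * e * N') = - s" using eqs by algebra
  show "(S - a * e * N) * (c * N) - (s * N) * (- a * s * N) = N * (c * S + a * e * N)"
    using eqs by algebra
  show "(S - a * e * N) * (C - a * e * N') + (s * N) * (s * N') = z * (S + e * N')"
    using eqs by algebra
  show "(S - a * e * N) * (- a * s * N) + (s * N) * (c * N) = z * (s * N)"
    using eqs by algebra
  show "(C - a * e * N')\<^sup>2 + (s * N')\<^sup>2 + k * (S + e * N')\<^sup>2 = 1"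
    using eqs by algebra
  show "(C - a * e * N') * (- a * s * N) + (s * N') * (c * N) + k * (S + e * N') * (s * N) = 0"
    using eqs by algebra
  show "(- a * s * N)\<^sup>2 + (c * N)\<^sup>2 + k * (s * N)\<^sup>2 = N\<^sup>2"
    using eqs by algebra
  show "(C - a * e * N') * (c * N) - (- a * s * N) * (s * N') = z * N"
    using eqs by algebra
  show "N * (1 + z)\<^sup>2 - (N' * (c * S + a * e * N) + N * (c * C + a * e * N')) * (1 + z)
        + N * (c * S + a * e * N) * (- k * (S + e * N')) = c * (1 + z) + k * s\<^sup>2 * N"
    using eqs by algebra
qed

text \<open>The potential is the integral of \<open>B\<close> along \<open>y\<close>, starting on
  the line y = y0. Differentiating under the integral produces the integral of \<open>C\<close>,
  which is A(x,y) - A(x,y0); so vanishing of \<open>A\<close> on that line makes the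
  \<open>x\<close>-derivative equal to \<open>A\<close>. Continuity of \<open>B\<close> upgrades the
  partial derivatives to a total one.\<close>

lemma closed_form_potential:
  fixes A B C :: "real \<Rightarrow> real \<Rightarrow> real"
  assumes X: "open X" "convex X" and y0: "y1 < y0" "y0 < y2"
    and A: "\<And>x y. x \<in> X \<Longrightarrow> y \<in> {y1..y2} \<Longrightarrow> (A x has_real_derivative C x y) (at y)"
    and B: "\<And>x y. x \<in> X \<Longrightarrow> y \<in> {y1..y2} \<Longrightarrow> ((\<lambda>x. B x y) has_real_derivative C x y) (at x)"
    and contC: "continuous_on (X \<times> {y1..y2}) (\<lambda>(x, y). C x y)"
    and contB: "continuous_on (X \<times> {y1..y2}) (\<lambda>(x, y). B x y)"
    and A0: "\<And>x. x \<in> X \<Longrightarrow> A x y0 = 0"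
  obtains \<psi> where "\<And>x. \<psi> (x, y0) = 0"
    "\<And>x y. x \<in> X \<Longrightarrow> y \<in> {y1<..<y2} \<Longrightarrow>
      (\<psi> has_derivative (\<lambda>(h, l). A x y * h + B x y * l)) (at (x, y))"
proof -
  \<comment> \<open>Subtracting two integrals from \<open>y1\<close> is valid on both sides of
    \<open>y0\<close>; an integral over \<open>{y0..y}\<close> would be 0 for y < y0.\<close>
  define \<psi> where "\<psi> x y = integral {y1..y} (B x) - integral {y1..y0} (B x)" for x y
  have contBx: "continuous_on {y1..y2} (B x)" if "x \<in> X" for x
  proof -
    have "continuous_on {y1..y2} (\<lambda>y. (\<lambda>(x, y). B x y) (x, y))"
      by (rule continuous_on_compose2[OF contB]) (use that in \<open>auto intro!: continuous_on_Pair\<close>)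
    then show ?thesis by simp
  qed
  have B_int: "B x integrable_on {y1..y}" if "x \<in> X" "y \<in> {y1..y2}" for x y
    using that by (intro integrable_continuous_real continuous_on_subset[OF contBx]) auto
  have dx: "((\<lambda>x. integral {y1..y} (B x)) has_real_derivative A x y - A x y1) (at x)"
    if x: "x \<in> X" and y: "y \<in> {y1..y2}" for x y
  proof -
    have "((\<lambda>x. integral (cbox y1 y) (B x)) has_real_derivative integral (cbox y1 y) (C x)) (at x within X)"
    proof (rule leibniz_rule_field_derivative)
      show "((\<lambda>x. B x t) has_real_derivative C x t) (at x within X)" if "x \<in> X" "t \<in> cbox y1 y" for x t
        using B[of x t] that y by (auto intro: has_field_derivative_at_within)
      show "B x integrable_on cbox y1 y" if "x \<in> X" for x
        using B_int[OF that y] by simp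
      show "continuous_on (X \<times> cbox y1 y) (\<lambda>(x, t). C x t)"
        by (rule continuous_on_subset[OF contC]) (use y in auto)
    qed (use x X in auto)
    moreover have "(C x has_integral (A x y - A x y1)) {y1..y}"
    proof (rule fundamental_theorem_of_calculus)
      show "(A x has_vector_derivative C x t) (at t within {y1..y})" if "t \<in> {y1..y}" for t
        using A[of x t, OF x, THEN has_field_derivative_at_within] that y
        unfolding has_real_derivative_iff_has_vector_derivative by simp
    qed (use y in auto)
    then have "integral {y1..y} (C x) = A x y - A x y1"
      by (rule integral_unique)
    ultimately show ?thesis
      by (simp only: at_within_open[OF x X(1)] cbox_interval)
  qed
  have within: "((\<lambda>(x, y). \<psi> x y) has_derivative (\<lambda>(h, l). A x y * h + blinfun_apply (blinfun_mult_right (B x y)) l))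
      (at (x, y) within X \<times> {y1<..<y2})" if x: "x \<in> X" and y: "y \<in> {y1<..<y2}" for x y
  proof (rule has_derivative_partialsI[where fy = "\<lambda>x y. blinfun_mult_right (B x y)"])
    have "((\<lambda>x. \<psi> x y) has_real_derivative (A x y - A x y1) - (A x y0 - A x y1)) (at x within X)"
      unfolding \<psi>_def using x y y0
      by (intro has_field_derivative_at_within[OF DERIV_diff[OF dx dx]]) auto
    then show "((\<lambda>x. \<psi> x y) has_derivative (\<lambda>h. A x y * h)) (at x within X)"
      using A0[OF x] by (simp add: has_field_derivative_def)
    fix x' y' assume x': "x' \<in> X" and y': "y' \<in> {y1<..<y2}"
    from integral_has_real_derivative[OF contBx[OF x'], of y'] y'
    have "((\<lambda>y. integral {y1..y} (B x')) has_real_derivative B x' y') (at y' within {y1<..<y2})"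
      by (intro has_field_derivative_subset[where s = "{y1..y2}" and t = "{y1<..<y2}"]) auto
    then have "((\<lambda>y. \<psi> x' y) has_real_derivative B x' y' - 0) (at y' within {y1<..<y2})"
      unfolding \<psi>_def by (intro DERIV_diff) auto
    then show "((\<lambda>y. \<psi> x' y) has_derivative blinfun_apply (blinfun_mult_right (B x' y')))
        (at y' within {y1<..<y2})"
      by (simp add: has_field_derivative_def)
  next
    have "continuous_on (X \<times> {y1<..<y2}) (\<lambda>(x, y). B x y)"
      by (rule continuous_on_subset[OF contB]) auto
    then have "continuous_on (X \<times> {y1<..<y2}) (\<lambda>(x, y). blinfun_mult_right (B x y))"
      unfolding split_def
      by (rule bounded_linear.continuous_on[OF bounded_linear_blinfun_mult_right])
    then show "continuous (at (x, y) within X \<times> {y1<..<y2}) (\<lambda>(x, y). blinfun_mult_right (B x y))"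
      using x y by (simp add: continuous_on_eq_continuous_within)
  qed (use y in auto)
  have op: "open (X \<times> {y1<..<y2})"
    using X(1) by (simp add: open_Times)
  have "((\<lambda>(x, y). \<psi> x y) has_derivative (\<lambda>(h, l). A x y * h + B x y * l)) (at (x, y))"
    if "x \<in> X" "y \<in> {y1<..<y2}" for x y
    using within[OF that] that by (simp add: at_within_open[OF _ op])
  moreover have "(\<lambda>(x, y). \<psi> x y) (x, y0) = 0" for x
    by (simp add: \<psi>_def)
  ultimately show ?thesis using that by blast
qed

text \<open>For \<open>\<kappa> > 0\<close> these are \<open>sin (\<surd>\<kappa> t) / \<surd>\<kappa>\<close>, \<open>cos (\<surd>\<kappa> t)\<close> and \<open>(1 - cos (\<surd>\<kappa> t)) / \<kappa>\<close>. Carrying the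
  third one along keeps all formulas valid for \<open>\<kappa> = 0\<close>.\<close>
lemma generalized_trigonometric_functions:
  fixes \<kappa> :: real
  obtains s c e :: "real \<Rightarrow> real" where "s 0 = 0" "c 0 = 1" "e 0 = 0"
    "\<And>t. (s has_real_derivative c t) (at t)" "\<And>t. (c has_real_derivative - \<kappa> * s t) (at t)"
    "\<And>t. (e has_real_derivative s t) (at t)" "\<And>t. c t = 1 - \<kappa> * e t"
    "\<And>t. (s t)\<^sup>2 = e t * (1 + c t)" "\<And>t. (c t)\<^sup>2 + \<kappa> * (s t)\<^sup>2 = 1"
proof -
  consider "\<kappa> > 0" | "\<kappa> = 0" | "\<kappa> < 0" by linarith
  then show ?thesis
  proof cases
    case 1
    define r where "r = sqrt \<kappa>"
    have r: "r \<noteq> 0" "\<kappa> = r\<^sup>2" using 1 by (auto simp: r_def)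
    have sc: "sin x ^ 2 = 1 - cos x ^ 2" for x :: real by (simp add: sin_squared_eq)
    show ?thesis
    proof (rule that[of "\<lambda>t. sin (r * t) / r" "\<lambda>t. cos (r * t)" "\<lambda>t. (1 - cos (r * t)) / \<kappa>"])
      show "((\<lambda>t. sin (r * t) / r) has_real_derivative cos (r * t)) (at t)" for t
        using r by (auto intro!: derivative_eq_intros)
      show "((\<lambda>t. cos (r * t)) has_real_derivative - \<kappa> * (sin (r * t) / r)) (at t)" for t
        using r by (auto intro!: derivative_eq_intros simp: power2_eq_square)
      show "((\<lambda>t. (1 - cos (r * t)) / \<kappa>) has_real_derivative sin (r * t) / r) (at t)" for t
        using r by (auto intro!: derivative_eq_intros simp: power2_eq_square)
    qed (use r sc in \<open>auto simp: field_simps power2_eq_square\<close>)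
  next
    case 2
    then show ?thesis
      by (intro that[of "\<lambda>t. t" "\<lambda>t. 1" "\<lambda>t. t\<^sup>2 / 2"]) (auto intro!: derivative_eq_intros)
  next
    case 3
    define r where "r = sqrt (- \<kappa>)"
    have r: "r \<noteq> 0" "\<kappa> = - r\<^sup>2" using 3 by (auto simp: r_def)
    have sc: "sinh x ^ 2 = cosh x ^ 2 - 1" for x :: real by (simp add: cosh_square_eq)
    show ?thesis
    proof (rule that[of "\<lambda>t. sinh (r * t) / r" "\<lambda>t. cosh (r * t)" "\<lambda>t. (1 - cosh (r * t)) / \<kappa>"])
      show "((\<lambda>t. sinh (r * t) / r) has_real_derivative cosh (r * t)) (at t)" for t
        using r by (auto intro!: derivative_eq_intros)
      show "((\<lambda>t. cosh (r * t)) has_real_derivative - \<kappa> * (sinh (r * t) / r)) (at t)" for t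
        using r by (auto intro!: derivative_eq_intros simp: power2_eq_square)
      show "((\<lambda>t. (1 - cosh (r * t)) / \<kappa>) has_real_derivative sinh (r * t) / r) (at t)" for t
        using r by (auto intro!: derivative_eq_intros simp: power2_eq_square)
    qed (use r sc in \<open>auto simp: field_simps power2_eq_square\<close>)
  qed
qed

text \<open>The linear span of \<open>s\<close>, \<open>c\<close>, \<open>e\<close> is closed under
  differentiation, so \<open>smooth_on_coinduct\<close> applies to it.\<close>

lemma smooth_on_generalized_trigonometric:
  fixes s c e :: "real \<Rightarrow> real"
  assumes "\<And>t. (s has_real_derivative c t) (at t)" "\<And>t. (c has_real_derivative - \<kappa> * s t) (at t)"
    "\<And>t. (e has_real_derivative s t) (at t)"
  shows "smooth_on UNIV s" "smooth_on UNIV c" "smooth_on UNIV e"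
proof -
  define P where "P f \<longleftrightarrow> (\<exists>\<alpha> \<beta> \<gamma>. f = (\<lambda>t. \<alpha> * s t + \<beta> * c t + \<gamma> * e t))" for f :: "real \<Rightarrow> real"
  have "smooth_on UNIV f" if "P f" for f
  proof (rule smooth_on_coinduct[of _ P])
    fix f assume "P f"
    then obtain \<alpha> \<beta> \<gamma> where f: "f = (\<lambda>t. \<alpha> * s t + \<beta> * c t + \<gamma> * e t)"
      unfolding P_def by blast
    have "(f has_real_derivative \<alpha> * c t + \<beta> * (- \<kappa> * s t) + \<gamma> * s t) (at t)" for t
      unfolding f using assms by (intro DERIV_add DERIV_cmult) auto
    then have "(f has_derivative (\<lambda>h. (\<alpha> * c t + \<beta> * (- \<kappa> * s t) + \<gamma> * s t) * h)) (at t)" for t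
      by (simp add: has_field_derivative_def)
    moreover have "P (\<lambda>t. (\<alpha> * c t + \<beta> * (- \<kappa> * s t) + \<gamma> * s t) * h)" for h
      unfolding P_def
      by (intro exI[of _ "(\<gamma> - \<beta> * \<kappa>) * h"] exI[of _ "\<alpha> * h"] exI[of _ 0]) (auto simp: algebra_simps)
    ultimately show "\<exists>f'. (\<forall>x\<in>UNIV. (f has_derivative f' x) (at x)) \<and> (\<forall>v. P (\<lambda>x. f' x v))"
      by (intro exI[of _ "\<lambda>t h. (\<alpha> * c t + \<beta> * (- \<kappa> * s t) + \<gamma> * s t) * h"]) auto
  qed (use that in auto)
  moreover have "P s" "P c" "P e"
    unfolding P_def
    by (rule exI[of _ 1], rule exI[of _ 0], rule exI[of _ 0], simp)
      (rule exI[of _ 0], rule exI[of _ 1], rule exI[of _ 0], simp,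
       rule exI[of _ 0], rule exI[of _ 0], rule exI[of _ 1], simp)
  ultimately show "smooth_on UNIV s" "smooth_on UNIV c" "smooth_on UNIV e" by auto
qed

section \<open>Functions of a single coordinate\<close>

lemma smooth_on_real_deriv:
  fixes f :: "real \<Rightarrow> real"
  assumes "open I" "smooth_on I f"
  shows "x \<in> I \<Longrightarrow> (f has_real_derivative deriv f x) (at x)" "smooth_on I (deriv f)"
proof -
  have der: "(f has_real_derivative frechet_derivative f (at x) 1) (at x)" if "x \<in> I" for x
  proof -
    have f': "(f has_derivative frechet_derivative f (at x)) (at x)"
      using smooth_on_has_derivative[OF assms(2) that] .
    have "frechet_derivative f (at x) = (*) (frechet_derivative f (at x) 1)"
    proof
      fix h
      show "frechet_derivative f (at x) h = frechet_derivative f (at x) 1 * h"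
        using linear_cmul[OF has_derivative_linear[OF f'], of h 1] by simp
    qed
    with f' show ?thesis unfolding has_field_derivative_def by metis
  qed
  then have eq: "frechet_derivative f (at x) 1 = deriv f x" if "x \<in> I" for x
    using DERIV_imp_deriv that by metis
  show "(f has_real_derivative deriv f x) (at x)" if "x \<in> I"
    using der eq that by metis
  show "smooth_on I (deriv f)"
    by (rule smooth_on_cong[OF assms(1) smooth_on_frechet[OF assms(2)] eq])
qed

lemma smooth_on_nth: "open A \<Longrightarrow> smooth_on A (\<lambda>q::real^'n. q $ i)"
  by (rule smooth_on_bounded_linear[OF _ bounded_linear_vec_nth])

lemma smooth_on_coordinate:
  fixes f :: "real \<Rightarrow> real"
  assumes "open A" "smooth_on UNIV f"
  shows "smooth_on A (\<lambda>q::real^'n. f (d * (q $ i - x)))"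
  by (rule smooth_on_compose[OF assms(1,2)])
    (use assms(1) in \<open>auto intro!: smooth_on_mult smooth_on_diff smooth_on_const smooth_on_nth\<close>)

lemma DERIV_affine:
  fixes f :: "real \<Rightarrow> real"
  assumes "(f has_real_derivative f') (at (d * (x - x\<^sub>0)))"
  shows "((\<lambda>x. f (d * (x - x\<^sub>0))) has_real_derivative d * f') (at x)"
proof -
  have "((\<lambda>x. d * (x - x\<^sub>0)) has_real_derivative d) (at x)"
    by (auto intro!: derivative_eq_intros)
  from DERIV_chain2[OF assms this] show ?thesis by (simp add: mult.commute)
qed

lemma coordinate_axis_sum:
  "(x *\<^sub>R axis 1 1 + y *\<^sub>R axis 2 1 + z *\<^sub>R axis 3 1 + w *\<^sub>R axis 4 (1::real) :: real^4) $ 1 = x"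
  "(x *\<^sub>R axis 1 1 + y *\<^sub>R axis 2 1 + z *\<^sub>R axis 3 1 + w *\<^sub>R axis 4 (1::real) :: real^4) $ 2 = y"
  "(x *\<^sub>R axis 1 1 + y *\<^sub>R axis 2 1 + z *\<^sub>R axis 3 1 + w *\<^sub>R axis 4 (1::real) :: real^4) $ 3 = z"
  "(x *\<^sub>R axis 1 1 + y *\<^sub>R axis 2 1 + z *\<^sub>R axis 3 1 + w *\<^sub>R axis 4 (1::real) :: real^4) $ 4 = w"
  by (simp_all add: axis_def)

text \<open>The surface of curvature \<open>k\<close>, seen as \<open>\<zeta>\<^sup>2 + k (\<xi>\<^sup>2 + \<eta>\<^sup>2) = 1\<close> near \<open>(\<zeta>, \<xi>, \<eta>) = (1, 0, 0)\<close> with metric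
  \<open>d\<xi>\<^sup>2 + d\<eta>\<^sup>2 + d\<zeta>\<^sup>2 / k\<close>, is charted by \<open>(\<xi>, \<eta>)\<close>; the \<open>1\<close>-form added to \<open>dt\<close> is a primitive of
  \<open>2 \<omega>\<close> times its area form.\<close>
definition model_metric :: "real \<Rightarrow> real \<Rightarrow> metric_field" where
  "model_metric k \<omega> q u v = (let r = sqrt (1 - k * ((q $ 2)\<^sup>2 + (q $ 3)\<^sup>2));
      \<theta> = (\<lambda>w::real^4. w $ 1 + 2 * \<omega> * (q $ 2 * w $ 3 - q $ 3 * w $ 2) / (1 + r));
      \<mu> = (\<lambda>w::real^4. (q $ 2 * w $ 2 + q $ 3 * w $ 3) / r)
    in \<theta> u * \<theta> v - (u $ 2 * v $ 2 + u $ 3 * v $ 3 + k * \<mu> u * \<mu> v) - u $ 4 * v $ 4)"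

text \<open>The square root is \<zeta>, and d\<xi> \<and> d\<eta> / \<zeta> is the area form of the
  quadric.\<close>

definition model_torsion :: "real \<Rightarrow> real \<Rightarrow> torsion_field" where
  "model_torsion k S\<^sub>0 q u v =
     axis 1 (S\<^sub>0 * (u $ 2 * v $ 3 - u $ 3 * v $ 2) / sqrt (1 - k * ((q $ 2)\<^sup>2 + (q $ 3)\<^sup>2)))"

text \<open>For dx^2 + D^2 dy^2 the lines y = const are unit-speed geodesics orthogonal to x = x0.
  Hence the curvature k and the geodesic curvature a of that line determine the surface locally, and
  \<open>F\<close> copies the line with these geodesics onto the quadric. The potential \<psi> added
  to t then turns the model 1-form into H dy.\<close>

lemma goedel_standard_chart:
  assumes I: "open I" and J: "open J" and H: "smooth_on I H" and D: "smooth_on I D"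
    and D0: "\<And>x. x \<in> I \<Longrightarrow> D x \<noteq> 0"
    and \<omega>: "\<And>x. x \<in> I \<Longrightarrow> deriv H x = 2 * \<omega> * D x"
    and k: "\<And>x. x \<in> I \<Longrightarrow> deriv (deriv D) x = - k * D x"
    and S: "\<And>z. z \<in> J \<Longrightarrow> S z = S\<^sub>0"
    and p: "p \<in> goedel_domain I J"
  shows "\<exists>U F. standard_chart (goedel_domain I J) (goedel_metric H D) (goedel_torsion D S)
    (model_metric k \<omega>) (model_torsion k S\<^sub>0) p U F"
proof -
  define x\<^sub>0 where "x\<^sub>0 = p $ 2"
  define y\<^sub>0 where "y\<^sub>0 = p $ 3"
  have x\<^sub>0: "x\<^sub>0 \<in> I" and p4: "p $ 4 \<in> J" using p by (auto simp: goedel_domain_def x\<^sub>0_def)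
  define d where "d = D x\<^sub>0"
  have d: "d \<noteq> 0" using D0[OF x\<^sub>0] by (simp add: d_def)
  define a where "a = deriv D x\<^sub>0 / d"
  obtain sk ck ek :: "real \<Rightarrow> real" where sk0: "sk 0 = 0" "ck 0 = 1"
    and sk': "\<And>t. (sk has_real_derivative ck t) (at t)" "\<And>t. (ck has_real_derivative - k * sk t) (at t)"
      "\<And>t. (ek has_real_derivative sk t) (at t)"
    and sk2: "\<And>t. (ck t)\<^sup>2 + k * (sk t)\<^sup>2 = 1"
    using generalized_trigonometric_functions[of k] by metis
  obtain s c e :: "real \<Rightarrow> real" where s0: "s 0 = 0" "c 0 = 1" "e 0 = 0"
    and s': "\<And>t. (s has_real_derivative c t) (at t)"
      "\<And>t. (c has_real_derivative - (k + a\<^sup>2) * s t) (at t)"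
      "\<And>t. (e has_real_derivative s t) (at t)"
    and ce: "\<And>t. c t = 1 - (k + a\<^sup>2) * e t" and s2: "\<And>t. (s t)\<^sup>2 = e t * (1 + c t)"
    using generalized_trigonometric_functions[of "k + a\<^sup>2"] by metis
  note sm = smooth_on_generalized_trigonometric[OF sk'] smooth_on_generalized_trigonometric[OF s']
  \<comment> \<open>The coordinate line \<open>x = x\<^sub>0\<close> has constant geodesic curvature \<open>a\<close>. In the quadric
    \<open>\<zeta>\<^sup>2 + k (\<xi>\<^sup>2 + \<eta>\<^sup>2) = 1\<close> it is an orbit of the rotations generated by
    \<open>(\<zeta>, \<xi>, \<eta>) \<mapsto> (- k \<eta>, - a \<eta>, \<zeta> + a \<xi>)\<close>; moving the geodesic \<open>(ck, sk, 0)\<close> by these rotations gives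
    the point \<open>(z, F2, F3)\<close> below.\<close>
  define C where "C x = ck (1 * (x - x\<^sub>0))" for x
  define X where "X x = sk (1 * (x - x\<^sub>0))" for x
  define N where "N x = C x + a * X x" for x
  define N' where "N' x = a * C x - k * X x" for x
  define \<sigma> where "\<sigma> y = s (d * (y - y\<^sub>0))" for y
  define \<gamma> where "\<gamma> y = c (d * (y - y\<^sub>0))" for y
  define \<epsilon> where "\<epsilon> y = e (d * (y - y\<^sub>0))" for y
  \<comment> \<open>Let Z be the generator above. Its cube is -(k + a^2) Z, so its flow is 1 +
    \<sigma> Z + \<epsilon> Z^2. Since Z (C, X, 0) = (0, 0, N) and Z^2 (C, X, 0) = (-k N, -a N, 0),
    the moved point is (C - k \<epsilon> N, X - a \<epsilon> N, \<sigma> N).\<close>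
  define z where "z x y = C x - k * \<epsilon> y * N x" for x y
  define G where "G x y = \<gamma> y * X x + a * \<epsilon> y * N x" for x y
  \<comment> \<open>The factor \<open>1 *\<close> in \<open>C\<close> and \<open>X\<close> gives
    them the shape that \<open>DERIV_affine\<close> and \<open>smooth_on_coordinate\<close> expect,
    with slope 1.\<close>
  have C': "(C has_real_derivative - k * X x) (at x)" for x
    using DERIV_affine[OF sk'(2), of 1 x\<^sub>0 x]
    by (simp add: C_def[abs_def] X_def[abs_def])
  have X': "(X has_real_derivative C x) (at x)" for x
    using DERIV_affine[OF sk'(1), of 1 x\<^sub>0 x]
    by (simp add: C_def[abs_def] X_def[abs_def])
  have N_der: "(N has_real_derivative N' x) (at x)" for x
    unfolding N_def N'_def by (rule derivative_eq_intros C' X' refl | simp)+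
  have \<sigma>': "(\<sigma> has_real_derivative d * \<gamma> y) (at y)" for y
    using DERIV_affine[OF s'(1), of d y\<^sub>0 y]
    by (simp add: \<sigma>_def[abs_def] \<gamma>_def[abs_def])
  have \<gamma>': "(\<gamma> has_real_derivative d * (- (k + a\<^sup>2) * \<sigma> y)) (at y)" for y
    using DERIV_affine[OF s'(2), of d y\<^sub>0 y]
    by (simp add: \<sigma>_def[abs_def] \<gamma>_def[abs_def])
  have \<epsilon>': "(\<epsilon> has_real_derivative d * \<sigma> y) (at y)" for y
    using DERIV_affine[OF s'(3), of d y\<^sub>0 y]
    by (simp add: \<sigma>_def[abs_def] \<epsilon>_def[abs_def])
  note ids = chart_identities[of "C x" k "X x" "\<gamma> y" a "\<epsilon> y" "\<sigma> y" "N x" "N' x" "z x y" for x y,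
      OF sk2[of "1 * (_ - x\<^sub>0)", folded C_def X_def] ce[of "d * (_ - y\<^sub>0)", folded \<gamma>_def \<epsilon>_def]
        s2[of "d * (_ - y\<^sub>0)", folded \<gamma>_def \<epsilon>_def \<sigma>_def] N_def N'_def z_def]
  have at0: "C x\<^sub>0 = 1" "X x\<^sub>0 = 0" "\<sigma> y\<^sub>0 = 0" "\<epsilon> y\<^sub>0 = 0" "\<gamma> y\<^sub>0 = 1"
    by (simp_all add: C_def X_def \<sigma>_def \<epsilon>_def \<gamma>_def sk0 s0)
  have D': "(D has_real_derivative deriv D x) (at x)" "(H has_real_derivative deriv H x) (at x)"
    "(deriv D has_real_derivative deriv (deriv D) x) (at x)" if "x \<in> I" for x
    using smooth_on_real_deriv[OF I] H D that by blast+
  obtain r1 where r1: "r1 > 0" "ball x\<^sub>0 r1 \<subseteq> I" using I x\<^sub>0 open_contains_ball by blast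
  have DN: "D x = d * N x" if x: "x \<in> ball x\<^sub>0 r1" for x
  proof -
    \<comment> \<open>Variation of constants: \<open>D\<close> and the pair \<open>C\<close>,
      \<open>X\<close> solve the same equation f'' = -k f, so these two Wronskian-type expressions
      are constant. Their values at x0 are the coefficients of \<open>D\<close> with respect to
      \<open>C\<close> and \<open>X\<close>.\<close>
    let ?P = "\<lambda>x. D x * C x - deriv D x * X x" and ?Q = "\<lambda>x. deriv D x * C x + k * D x * X x"
    have P': "(?P has_real_derivative 0) (at x within ball x\<^sub>0 r1)" if "x \<in> ball x\<^sub>0 r1" for x
    proof -
      have xI: "x \<in> I" using that r1 by auto
      have "(?P has_real_derivative 0) (at x)"
        by (rule derivative_eq_intros D'[OF xI] C' X' refl | simp add: k[OF xI] algebra_simps)+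
      then show ?thesis by (rule has_field_derivative_at_within)
    qed
    have Q': "(?Q has_real_derivative 0) (at x within ball x\<^sub>0 r1)" if "x \<in> ball x\<^sub>0 r1" for x
    proof -
      have xI: "x \<in> I" using that r1 by auto
      have "(?Q has_real_derivative 0) (at x)"
        by (rule derivative_eq_intros D'[OF xI] C' X' refl | simp add: k[OF xI] algebra_simps)+
      then show ?thesis by (rule has_field_derivative_at_within)
    qed
    obtain P where "\<forall>x\<in>ball x\<^sub>0 r1. ?P x = P"
      using has_field_derivative_zero_constant[OF convex_ball P'] by blast
    moreover obtain Q where "\<forall>x\<in>ball x\<^sub>0 r1. ?Q x = Q"
      using has_field_derivative_zero_constant[OF convex_ball Q'] by blast
    ultimately have "?P x = ?P x\<^sub>0" "?Q x = ?Q x\<^sub>0" using x r1(1) by simp_all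
    then have PQ: "?P x = d" "?Q x = a * d" using d by (simp_all add: at0 d_def[symmetric] a_def)
    have "d * N x = d * C x + (a * d) * X x" by (simp add: N_def algebra_simps)
    also have "\<dots> = ?P x * C x + ?Q x * X x" by (simp only: PQ)
    also have "\<dots> = D x * ((C x)\<^sup>2 + k * (X x)\<^sup>2)"
      by (simp add: power2_eq_square algebra_simps)
    also have "(C x)\<^sup>2 + k * (X x)\<^sup>2 = 1" by (simp only: C_def X_def sk2)
    finally show ?thesis by simp
  qed

  have cont: "continuous_on S (\<lambda>w. C (f w))" "continuous_on S (\<lambda>w. X (f w))"
      "continuous_on S (\<lambda>w. \<sigma> (f w))" "continuous_on S (\<lambda>w. \<gamma> (f w))" "continuous_on S (\<lambda>w. \<epsilon> (f w))"
    if "continuous_on S f" for S and f :: "real \<times> real \<Rightarrow> real"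
    by (rule continuous_on_compose2[OF DERIV_continuous_on that subset_UNIV],
        rule has_field_derivative_at_within, rule C' X' \<sigma>' \<gamma>' \<epsilon>')+
  have contN: "continuous_on S (\<lambda>w. N (fst w))" for S :: "(real \<times> real) set"
    unfolding N_def by (intro continuous_intros cont)
  have contz: "continuous_on S (\<lambda>w. z (fst w) (snd w))" for S
    unfolding z_def by (intro continuous_intros cont contN)
  \<comment> \<open>Positivity of \<open>z\<close> makes it the square root in the model, keeps 1 +
    z away from 0 and, with N nonzero, makes the Jacobian nonzero.\<close>
  have "open {w. 0 < z (fst w) (snd w)}"
    by (intro open_Collect_less continuous_on_const contz)
  moreover have "(x\<^sub>0, y\<^sub>0) \<in> {w. 0 < z (fst w) (snd w)}"
    by (simp add: z_def at0)
  ultimately obtain V\<^sub>x V\<^sub>y where "open V\<^sub>x" "open V\<^sub>y" "(x\<^sub>0, y\<^sub>0) \<in> V\<^sub>x \<times> V\<^sub>y"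
    and zV: "V\<^sub>x \<times> V\<^sub>y \<subseteq> {w. 0 < z (fst w) (snd w)}"
    by (rule open_prod_elim)
  \<comment> \<open>The neighbourhood is closed in \<open>y\<close>, because the potential is built
    by integration over a closed \<open>y\<close>-interval.\<close>
  then obtain r2 r3 where r2: "r2 > 0" "ball x\<^sub>0 r2 \<subseteq> V\<^sub>x" and r3: "r3 > 0" "cball y\<^sub>0 r3 \<subseteq> V\<^sub>y"
    by (metis mem_Times_iff fst_conv snd_conv open_contains_ball open_contains_cball)
  define r where "r = min r1 r2"
  have zpos: "z x y > 0" if "x \<in> ball x\<^sub>0 r" "y \<in> {y\<^sub>0 - r3..y\<^sub>0 + r3}" for x y
  proof -
    have "(x, y) \<in> V\<^sub>x \<times> V\<^sub>y"
      using that r2 r3 by (auto simp: r_def cball_eq_atLeastAtMost subset_iff)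
    then show ?thesis using zV by auto
  qed
  have rI: "ball x\<^sub>0 r \<subseteq> I" and r0: "r > 0" using r1 r2 by (auto simp: r_def)
  have DN: "D x = d * N x" if "x \<in> ball x\<^sub>0 r" for x
    using DN that by (simp add: r_def)
  \<comment> \<open>\<open>A dx + B dy\<close> is \<open>H dy\<close> minus the pullback of the model \<open>1\<close>-form, and \<open>R\<close> is \<open>\<partial>\<^sub>y A = \<partial>\<^sub>x B\<close>.\<close>
  define A where "A x y = 2 * \<omega> * (\<sigma> y / (1 + z x y))" for x y
  define B where "B x y = H x - 2 * \<omega> * d * (N x * G x y / (1 + z x y))" for x y
  define R where "R x y = 2 * \<omega> * d * ((\<gamma> y * (1 + z x y) + k * (\<sigma> y)\<^sup>2 * N x) / (1 + z x y)\<^sup>2)" for x y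
  have Ay: "(A x has_real_derivative R x y) (at y)"
    if xy: "x \<in> ball x\<^sub>0 r" "y \<in> {y\<^sub>0 - r3..y\<^sub>0 + r3}" for x y
  proof -
    have z1: "1 + z x y \<noteq> 0" using zpos[OF xy] by simp
    have "((\<lambda>y. 1 + z x y) has_real_derivative - (k * (d * \<sigma> y) * N x)) (at y)"
      unfolding z_def by (rule derivative_eq_intros \<epsilon>' refl | simp)+
    from DERIV_cmult[OF DERIV_divide[OF \<sigma>' this z1], of "2 * \<omega>"]
    show ?thesis
      unfolding A_def[abs_def] R_def
      by (rule DERIV_cong) (simp add: power2_eq_square algebra_simps)
  qed
  have Bx: "((\<lambda>x. B x y) has_real_derivative R x y) (at x)"
    if xy: "x \<in> ball x\<^sub>0 r" "y \<in> {y\<^sub>0 - r3..y\<^sub>0 + r3}" for x y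
  proof -
    have z1: "1 + z x y \<noteq> 0" using zpos[OF xy] by simp
    have xI: "x \<in> I" using xy rI by auto
    have dz: "((\<lambda>x. 1 + z x y) has_real_derivative - k * (X x + \<epsilon> y * N' x)) (at x)"
      unfolding z_def by (rule derivative_eq_intros C' N_der refl | simp add: algebra_simps)+
    have dG: "((\<lambda>x. G x y) has_real_derivative \<gamma> y * C x + a * \<epsilon> y * N' x) (at x)"
      unfolding G_def by (rule derivative_eq_intros X' N_der refl | simp add: algebra_simps)+
    let ?M = "(N' x * G x y + (\<gamma> y * C x + a * \<epsilon> y * N' x) * N x) * (1 + z x y)
      - (N x * G x y) * (- k * (X x + \<epsilon> y * N' x))"
    \<comment> \<open>This is the curl identity. Together with H' = 2 \<omega> d N it makes A dx + B
      dy closed.\<close>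
    have R: "\<gamma> y * (1 + z x y) + k * (\<sigma> y)\<^sup>2 * N x = N x * (1 + z x y)\<^sup>2 - ?M"
      using ids(10)[of x y] unfolding G_def by (simp add: algebra_simps)
    have "((\<lambda>x. B x y) has_real_derivative
        deriv H x - 2 * \<omega> * d * (?M / ((1 + z x y) * (1 + z x y)))) (at x)"
      unfolding B_def
      by (rule DERIV_diff[OF D'(2)[OF xI] DERIV_cmult[OF DERIV_divide[OF DERIV_mult'[OF N_der dG, THEN DERIV_cong] dz z1]]])
        (simp add: algebra_simps)
    then show ?thesis
    proof (rule DERIV_cong)
      have "R x y = 2 * \<omega> * d * (N x - ?M / (1 + z x y)\<^sup>2)"
        unfolding R_def R using z1 by (simp add: diff_divide_distrib)
      then show "deriv H x - 2 * \<omega> * d * (?M / ((1 + z x y) * (1 + z x y))) = R x y"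
        using \<omega>[OF xI] DN[OF xy(1)] by (simp add: power2_eq_square algebra_simps)
    qed
  qed
  have contR: "continuous_on (ball x\<^sub>0 r \<times> {y\<^sub>0 - r3..y\<^sub>0 + r3}) (\<lambda>(x, y). R x y)"
  proof -
    have "(1 + z (fst w) (snd w))\<^sup>2 \<noteq> 0" if "w \<in> ball x\<^sub>0 r \<times> {y\<^sub>0 - r3..y\<^sub>0 + r3}" for w
      using zpos[of "fst w" "snd w"] that by (simp add: mem_Times_iff)
    then show ?thesis
      unfolding split_def R_def by (intro continuous_intros cont contN contz ballI)
  qed
  have contB: "continuous_on (ball x\<^sub>0 r \<times> {y\<^sub>0 - r3..y\<^sub>0 + r3}) (\<lambda>(x, y). B x y)"
  proof -
    have "1 + z (fst w) (snd w) \<noteq> 0" if "w \<in> ball x\<^sub>0 r \<times> {y\<^sub>0 - r3..y\<^sub>0 + r3}" for w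
      using zpos[of "fst w" "snd w"] that by (simp add: mem_Times_iff)
    moreover have "continuous_on (ball x\<^sub>0 r \<times> {y\<^sub>0 - r3..y\<^sub>0 + r3}) (\<lambda>w. H (fst w))"
      by (rule continuous_on_compose2[OF smooth_on_continuous_on[OF H]])
        (use rI in \<open>auto intro!: continuous_on_fst continuous_on_id\<close>)
    ultimately show ?thesis
      unfolding split_def B_def G_def by (intro continuous_intros cont contN contz ballI)
  qed
  have ry: "y\<^sub>0 - r3 < y\<^sub>0" "y\<^sub>0 < y\<^sub>0 + r3" using r3 by simp_all
  obtain \<psi> where \<psi>0: "\<And>x. \<psi> (x, y\<^sub>0) = 0"
    and \<psi>': "\<And>x y. x \<in> ball x\<^sub>0 r \<Longrightarrow> y \<in> {y\<^sub>0 - r3<..<y\<^sub>0 + r3} \<Longrightarrow>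
      (\<psi> has_derivative (\<lambda>(h, l). A x y * h + B x y * l)) (at (x, y))"
    by (rule closed_form_potential[OF open_ball convex_ball ry Ay Bx contR contB])
      (auto simp: A_def at0)

  define W where "W = {q::real^4. q $ 2 \<in> ball x\<^sub>0 r \<and> q $ 3 \<in> {y\<^sub>0 - r3<..<y\<^sub>0 + r3} \<and> q $ 4 \<in> J}"
  have "W = (\<lambda>q. q $ 2) -` ball x\<^sub>0 r \<inter> (\<lambda>q. q $ 3) -` {y\<^sub>0 - r3<..<y\<^sub>0 + r3} \<inter> (\<lambda>q. q $ 4) -` J"
    by (auto simp: W_def)
  then have W: "open W"
    by (simp only:) (intro open_Int open_vimage J open_ball open_greaterThanLessThan
        continuous_on_component continuous_on_id)
  have WM: "W \<subseteq> goedel_domain I J" using rI by (auto simp: W_def goedel_domain_def)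
  have pW: "p \<in> W" using r0 r3 p4 by (auto simp: W_def x\<^sub>0_def y\<^sub>0_def)
  have zW: "z (q $ 2) (q $ 3) > 0" if "q \<in> W" for q
    using that by (intro zpos) (auto simp: W_def)
  have NW: "N (q $ 2) \<noteq> 0" "D (q $ 2) = d * N (q $ 2)" if "q \<in> W" for q
    using DN[of "q $ 2"] D0[of "q $ 2"] that WM by (auto simp: W_def goedel_domain_def)
  note sm_intros = smooth_on_add[OF W] smooth_on_diff[OF W] smooth_on_mult[OF W] smooth_on_uminus[OF W]
    smooth_on_const[OF W] smooth_on_nth[OF W] smooth_on_divide[OF W]
  have sm_basic: "smooth_on W (\<lambda>q. C (q $ 2))" "smooth_on W (\<lambda>q. X (q $ 2))"
    "smooth_on W (\<lambda>q. \<sigma> (q $ 3))" "smooth_on W (\<lambda>q. \<gamma> (q $ 3))" "smooth_on W (\<lambda>q. \<epsilon> (q $ 3))"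
    unfolding C_def X_def \<sigma>_def \<gamma>_def \<epsilon>_def by (rule smooth_on_coordinate[OF W], rule sm)+
  have smN: "smooth_on W (\<lambda>q. N (q $ 2))" "smooth_on W (\<lambda>q. N' (q $ 2))"
    unfolding N_def N'_def by (intro sm_intros sm_basic)+
  have smH: "smooth_on W (\<lambda>q. H (q $ 2))"
    by (rule smooth_on_compose[OF W H]) (use W WM in \<open>auto intro: smooth_on_nth simp: goedel_domain_def\<close>)
  have smz: "smooth_on W (\<lambda>q. z (q $ 2) (q $ 3))"
    unfolding z_def by (intro sm_intros sm_basic smN)
  have z1W: "1 + z (q $ 2) (q $ 3) \<noteq> 0" if "q \<in> W" for q
    using zW[OF that] by simp
  have smA: "smooth_on W (\<lambda>q. A (q $ 2) (q $ 3))" "smooth_on W (\<lambda>q. B (q $ 2) (q $ 3))"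
    unfolding A_def B_def G_def by (intro sm_intros sm_basic smN smH smz z1W; assumption)+
  have \<psi>W: "((\<lambda>q. \<psi> (q $ 2, q $ 3)) has_derivative
      (\<lambda>u. A (q $ 2) (q $ 3) * u $ 2 + B (q $ 2) (q $ 3) * u $ 3)) (at q)" if "q \<in> W" for q
  proof -
    have "((\<lambda>q::real^4. (q $ 2, q $ 3)) has_derivative (\<lambda>u. (u $ 2, u $ 3))) (at q)"
      by (intro has_derivative_Pair bounded_linear_imp_has_derivative bounded_linear_vec_nth)
    from has_derivative_compose[OF this \<psi>'] that show ?thesis by (simp add: W_def)
  qed
  have sm\<psi>: "smooth_on W (\<lambda>q. \<psi> (q $ 2, q $ 3))"
    by (rule smooth_on_derivativeI[OF W \<psi>W]) (assumption, intro sm_intros smA)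
  define F1 where "F1 q = q $ 1 - p $ 1 + \<psi> (q $ 2, q $ 3)" for q :: "real^4"
  define F2 where "F2 q = X (q $ 2) - a * \<epsilon> (q $ 3) * N (q $ 2)" for q :: "real^4"
  define F3 where "F3 q = \<sigma> (q $ 3) * N (q $ 2)" for q :: "real^4"
  define F where "F q = F1 q *\<^sub>R axis 1 1 + F2 q *\<^sub>R axis 2 1 + F3 q *\<^sub>R axis 3 1
    + (q $ 4 - p $ 4) *\<^sub>R (axis 4 1 :: real^4)" for q :: "real^4"
  define F2' where "F2' q u = (C (q $ 2) - a * \<epsilon> (q $ 3) * N' (q $ 2)) * u $ 2
    + d * (- a * \<sigma> (q $ 3) * N (q $ 2)) * u $ 3" for q u :: "real^4"
  define F3' where "F3' q u = \<sigma> (q $ 3) * N' (q $ 2) * u $ 2 + d * (\<gamma> (q $ 3) * N (q $ 2)) * u $ 3"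
    for q u :: "real^4"
  define F' where "F' q u = (u $ 1 + (A (q $ 2) (q $ 3) * u $ 2 + B (q $ 2) (q $ 3) * u $ 3)) *\<^sub>R axis 1 1
    + F2' q u *\<^sub>R axis 2 1 + F3' q u *\<^sub>R axis 3 1 + u $ 4 *\<^sub>R (axis 4 1 :: real^4)" for q u :: "real^4"
  have nth_der: "((\<lambda>q::real^4. q $ i) has_derivative (\<lambda>u. u $ i)) (at q)" for i and q :: "real^4"
    by (intro bounded_linear_imp_has_derivative bounded_linear_vec_nth)
  have F_der: "(F has_derivative F' q) (at q)" if q: "q \<in> W" for q
  proof -
    have "(F1 has_derivative (\<lambda>u. u $ 1 - 0 + (A (q $ 2) (q $ 3) * u $ 2 + B (q $ 2) (q $ 3) * u $ 3))) (at q)"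
      unfolding F1_def[abs_def]
      by (intro has_derivative_add has_derivative_diff has_derivative_const nth_der \<psi>W q)
    moreover have "(F2 has_derivative F2' q) (at q)"
      unfolding F2_def[abs_def]
      by (rule has_derivative_eq_rhs[OF has_derivative_diff[OF DERIV_compose_FDERIV[OF X' nth_der]
            has_derivative_mult[OF has_derivative_mult_right[OF DERIV_compose_FDERIV[OF \<epsilon>' nth_der]]
              DERIV_compose_FDERIV[OF N_der nth_der]]]])
        (auto simp: F2'_def fun_eq_iff algebra_simps)
    moreover have "(F3 has_derivative F3' q) (at q)"
      unfolding F3_def[abs_def]
      by (rule has_derivative_eq_rhs[OF has_derivative_mult[OF DERIV_compose_FDERIV[OF \<sigma>' nth_der]
              DERIV_compose_FDERIV[OF N_der nth_der]]])
        (auto simp: F3'_def fun_eq_iff algebra_simps)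
    moreover have "((\<lambda>q. q $ 4 - p $ 4) has_derivative (\<lambda>u. u $ 4 - 0)) (at q)"
      by (intro has_derivative_diff has_derivative_const nth_der)
    ultimately show ?thesis
      unfolding F_def[abs_def] F'_def[abs_def]
      by (intro has_derivative_add has_derivative_scaleR_left) simp_all
  qed
  have F'_nth: "F' q u $ 1 = u $ 1 + (A (q $ 2) (q $ 3) * u $ 2 + B (q $ 2) (q $ 3) * u $ 3)"
    "F' q u $ 2 = F2' q u" "F' q u $ 3 = F3' q u" "F' q u $ 4 = u $ 4" for q u
    unfolding F'_def by (rule coordinate_axis_sum)+
  have F_nth: "F q $ 1 = F1 q" "F q $ 2 = F2 q" "F q $ 3 = F3 q" "F q $ 4 = q $ 4 - p $ 4" for q
    unfolding F_def by (rule coordinate_axis_sum)+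
  have smF: "smooth_on W F"
  proof (rule smooth_on_vec[OF W])
    have "\<forall>i. smooth_on W (\<lambda>q. F q $ i)"
      unfolding forall_4 F_nth F1_def F2_def F3_def
      by (intro conjI sm_intros sm_basic smN sm\<psi>)
    then show "smooth_on W (\<lambda>q. F q $ i)" for i by blast
  qed
  \<comment> \<open>Cramer's rule for the block of F' in the \<open>x\<close> and \<open>y\<close>
    directions, whose determinant is d z N by the ninth identity.\<close>
  define b2 where "b2 q v = (\<gamma> (q $ 3) * N (q $ 2) * v $ 2 + a * \<sigma> (q $ 3) * N (q $ 2) * v $ 3)
    / (z (q $ 2) (q $ 3) * N (q $ 2))" for q v :: "real^4"
  define b3 where "b3 q v = ((C (q $ 2) - a * \<epsilon> (q $ 3) * N' (q $ 2)) * v $ 3 - \<sigma> (q $ 3) * N' (q $ 2) * v $ 2)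
    / (d * (z (q $ 2) (q $ 3) * N (q $ 2)))" for q v :: "real^4"
  define F'inv where "F'inv q v = (v $ 1 - (A (q $ 2) (q $ 3) * b2 q v + B (q $ 2) (q $ 3) * b3 q v)) *\<^sub>R axis 1 1
    + b2 q v *\<^sub>R axis 2 1 + b3 q v *\<^sub>R axis 3 1 + v $ 4 *\<^sub>R (axis 4 1 :: real^4)" for q v :: "real^4"
  have smF'inv: "smooth_on W (\<lambda>q. F'inv q v)" for v
  proof (rule smooth_on_vec[OF W])
    have zN: "z (q $ 2) (q $ 3) * N (q $ 2) \<noteq> 0" "d * (z (q $ 2) (q $ 3) * N (q $ 2)) \<noteq> 0" if "q \<in> W" for q
      using zW[OF that] NW[OF that] d by simp_all
    have b: "smooth_on W (\<lambda>q. b2 q v)" "smooth_on W (\<lambda>q. b3 q v)"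
      unfolding b2_def b3_def by (intro sm_intros sm_basic smN smz zN; assumption)+
    have "\<forall>i. smooth_on W (\<lambda>q. F'inv q v $ i)"
      unfolding forall_4 F'inv_def coordinate_axis_sum
      by (intro conjI sm_intros b smA)
    then show "smooth_on W (\<lambda>q. F'inv q v $ i)" for i by blast
  qed
  have left_inv: "F'inv q (F' q u) = u" if q: "q \<in> W" for q u
  proof -
    have zN: "z (q $ 2) (q $ 3) * N (q $ 2) \<noteq> 0" using zW[OF q] NW[OF q] by simp
    have "\<gamma> (q $ 3) * N (q $ 2) * F2' q u + a * \<sigma> (q $ 3) * N (q $ 2) * F3' q u
        = u $ 2 * (z (q $ 2) (q $ 3) * N (q $ 2))"
      unfolding ids(9)[of "q $ 2" "q $ 3", symmetric] F2'_def F3'_def by (simp add: algebra_simps)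
    then have b2: "b2 q (F' q u) = u $ 2"
      unfolding b2_def F'_nth using zN by simp
    have "(C (q $ 2) - a * \<epsilon> (q $ 3) * N' (q $ 2)) * F3' q u - \<sigma> (q $ 3) * N' (q $ 2) * F2' q u
        = u $ 3 * (d * (z (q $ 2) (q $ 3) * N (q $ 2)))"
      unfolding ids(9)[of "q $ 2" "q $ 3", symmetric] F2'_def F3'_def by (simp add: algebra_simps)
    then have b3: "b3 q (F' q u) = u $ 3"
      unfolding b3_def F'_nth using zN d by simp
    show ?thesis
      unfolding vec_eq_iff forall_4
      by (simp only: F'inv_def coordinate_axis_sum b2 b3 F'_nth) simp
  qed
  have F'_eq: "frechet_derivative F (at q) = F' q" if "q \<in> W" for q
    using frechet_derivative_at[OF F_der[OF that]] by simp
  obtain U where U: "open U" "U \<subseteq> W" "p \<in> U" "open (F ` U)" "inj_on F U" "smooth_on (F ` U) (inv_into U F)"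
    by (rule smooth_local_inverse[where B = F'inv, OF W pW smF]) (simp_all add: F'_eq left_inv smF'inv)
  have F0: "F p = 0"
    unfolding vec_eq_iff forall_4 F_nth F1_def F2_def F3_def
    using \<psi>0[of x\<^sub>0] by (simp add: at0 flip: x\<^sub>0_def y\<^sub>0_def)
  have iso: "model_metric k \<omega> (F q) (F' q u) (F' q v) = goedel_metric H D q u v" (is ?th1)
    "model_torsion k S\<^sub>0 (F q) (F' q u) (F' q v) = F' q (goedel_torsion D S q u v)" (is ?th2)
    if q: "q \<in> W" for q u v
  proof -
    let ?x = "q $ 2" and ?y = "q $ 3"
    note id = ids[of ?x ?y]
    have root: "sqrt (1 - k * ((F2 q)\<^sup>2 + (F3 q)\<^sup>2)) = z ?x ?y"
      unfolding F2_def F3_def id(1)[symmetric] using zW[OF q] by simp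
    \<comment> \<open>The differential of \<psi> cancels the model 1-form against H dy, leaving dt +
      H dy.\<close>
    have \<theta>: "F' q w $ 1 + 2 * \<omega> * (F2 q * F3' q w - F3 q * F2' q w) / (1 + z ?x ?y)
        = w $ 1 + H ?x * w $ 3" for w
    proof -
      have "F2 q * F3' q w - F3 q * F2' q w
        = ((X ?x - a * \<epsilon> ?y * N ?x) * (\<sigma> ?y * N' ?x) - \<sigma> ?y * N ?x * (C ?x - a * \<epsilon> ?y * N' ?x)) * w $ 2
        + d * ((X ?x - a * \<epsilon> ?y * N ?x) * (\<gamma> ?y * N ?x) - \<sigma> ?y * N ?x * (- a * \<sigma> ?y * N ?x)) * w $ 3"
        unfolding F2_def F3_def F2'_def F3'_def by (simp add: algebra_simps)
      then have eq: "F2 q * F3' q w - F3 q * F2' q w = - \<sigma> ?y * w $ 2 + d * (N ?x * G ?x ?y) * w $ 3"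
        unfolding id(2,3) G_def .
      show ?thesis
        unfolding F'_nth A_def B_def eq by (simp add: algebra_simps add_divide_distrib diff_divide_distrib)
    qed
    have \<mu>: "(F2 q * F2' q w + F3 q * F3' q w) / z ?x ?y
        = (X ?x + \<epsilon> ?y * N' ?x) * w $ 2 + d * (\<sigma> ?y * N ?x) * w $ 3" for w
    proof -
      have "F2 q * F2' q w + F3 q * F3' q w
        = ((X ?x - a * \<epsilon> ?y * N ?x) * (C ?x - a * \<epsilon> ?y * N' ?x) + \<sigma> ?y * N ?x * (\<sigma> ?y * N' ?x)) * w $ 2
        + d * ((X ?x - a * \<epsilon> ?y * N ?x) * (- a * \<sigma> ?y * N ?x) + \<sigma> ?y * N ?x * (\<gamma> ?y * N ?x)) * w $ 3"
        unfolding F2_def F3_def F2'_def F3'_def by (simp add: algebra_simps)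
      then have "F2 q * F2' q w + F3 q * F3' q w
        = z ?x ?y * ((X ?x + \<epsilon> ?y * N' ?x) * w $ 2 + d * (\<sigma> ?y * N ?x) * w $ 3)"
        unfolding id(4,5) by (simp add: algebra_simps)
      then show ?thesis using zW[OF q] by simp
    qed
    have quad: "F2' q u * F2' q v + F3' q u * F3' q v
        + k * ((X ?x + \<epsilon> ?y * N' ?x) * u $ 2 + d * (\<sigma> ?y * N ?x) * u $ 3)
            * ((X ?x + \<epsilon> ?y * N' ?x) * v $ 2 + d * (\<sigma> ?y * N ?x) * v $ 3)
        = u $ 2 * v $ 2 + (D ?x)\<^sup>2 * u $ 3 * v $ 3"
    proof -
      \<comment> \<open>The form is expanded over its Gram matrix; the three premises are the
        entries supplied by identities 6 to 8.\<close>
      have gen: "(P * u2 + d' * p * u3) * (P * v2 + d' * p * v3) + (Q * u2 + d' * q * u3) * (Q * v2 + d' * q * v3)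
          + k' * (M * u2 + d' * m * u3) * (M * v2 + d' * m * v3) = u2 * v2 + (d' * n)\<^sup>2 * u3 * v3"
        if "P\<^sup>2 + Q\<^sup>2 + k' * M\<^sup>2 = 1" "P * p + Q * q + k' * M * m = 0" "p\<^sup>2 + q\<^sup>2 + k' * m\<^sup>2 = n\<^sup>2"
        for P Q M p q m k' d' n u2 u3 v2 v3 :: real
      proof -
        have "(P * u2 + d' * p * u3) * (P * v2 + d' * p * v3) + (Q * u2 + d' * q * u3) * (Q * v2 + d' * q * v3)
          + k' * (M * u2 + d' * m * u3) * (M * v2 + d' * m * v3)
          = (P\<^sup>2 + Q\<^sup>2 + k' * M\<^sup>2) * (u2 * v2) + (P * p + Q * q + k' * M * m) * (d' * (u2 * v3 + u3 * v2))
            + (p\<^sup>2 + q\<^sup>2 + k' * m\<^sup>2) * (d'\<^sup>2 * u3 * v3)"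
          by (simp add: algebra_simps power2_eq_square)
        also have "\<dots> = u2 * v2 + (d' * n)\<^sup>2 * u3 * v3"
          unfolding that by (simp add: power_mult_distrib)
        finally show ?thesis .
      qed
      show ?thesis
        unfolding F2'_def F3'_def NW(2)[OF q] using gen[OF id(6) id(7) ids(8)[of ?y ?x]] .
    qed
    show ?th1
      unfolding model_metric_def Let_def goedel_metric_def F_nth root
      unfolding F'_nth(2-4) \<theta> \<mu> quad by simp
    have det: "F2' q u * F3' q v - F3' q u * F2' q v = z ?x ?y * D ?x * (u $ 2 * v $ 3 - u $ 3 * v $ 2)"
    proof -
      have "F2' q u * F3' q v - F3' q u * F2' q v = d * ((C ?x - a * \<epsilon> ?y * N' ?x) * (\<gamma> ?y * N ?x)
          - (- a * \<sigma> ?y * N ?x) * (\<sigma> ?y * N' ?x)) * (u $ 2 * v $ 3 - u $ 3 * v $ 2)"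
        unfolding F2'_def F3'_def by (simp add: algebra_simps)
      then show ?thesis unfolding id(9) NW(2)[OF q] by simp
    qed
    have "F' q (axis 1 t) = axis 1 t" for t
      unfolding vec_eq_iff forall_4 F'_nth F2'_def F3'_def by (simp add: axis_def)
    moreover have "S (q $ 4) = S\<^sub>0" using q by (auto simp: W_def S)
    ultimately show ?th2
      unfolding model_torsion_def goedel_torsion_def F_nth root F'_nth det
      using zW[OF q] by (simp add: ac_simps)
  qed
  show ?thesis
    unfolding standard_chart_def Let_def
  proof (intro exI[of _ U] exI[of _ F] conjI ballI allI)
    show "U \<subseteq> goedel_domain I J" using U WM by blast
    show "smooth_on U F" using smooth_on_subset[OF smF U(2)] .
    fix q u v assume "q \<in> U"
    then have "q \<in> W" using U(2) by blast
    then show "model_metric k \<omega> (F q) (frechet_derivative F (at q) u) (frechet_derivative F (at q) v)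
        = goedel_metric H D q u v"
      "model_torsion k S\<^sub>0 (F q) (frechet_derivative F (at q) u) (frechet_derivative F (at q) v)
        = frechet_derivative F (at q) (goedel_torsion D S q u v)"
      by (simp_all add: F'_eq iso)
  qed (use U F0 in auto)
qed

section \<open>Symmetry of second derivatives and chain rules\<close>

text \<open>The mean value theorem is applied along \<open>u\<close> to the increment of
  \<open>f\<close> over h v, then along \<open>v\<close> to the derivative in direction
  \<open>u\<close>. The second difference on the left does not depend on the order of
  \<open>u\<close> and \<open>v\<close>.\<close>

lemma second_difference_mean_value:
  fixes f :: "'a::real_normed_vector \<Rightarrow> real"
  assumes h: "h > 0"
    and f': "\<And>s t. 0 \<le> s \<Longrightarrow> s \<le> h \<Longrightarrow> 0 \<le> t \<Longrightarrow> t \<le> h \<Longrightarrow>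
      (f has_derivative f' (p + s *\<^sub>R u + t *\<^sub>R v)) (at (p + s *\<^sub>R u + t *\<^sub>R v))"
    and f'': "\<And>s t. 0 \<le> s \<Longrightarrow> s \<le> h \<Longrightarrow> 0 \<le> t \<Longrightarrow> t \<le> h \<Longrightarrow>
      ((\<lambda>x. f' x u) has_derivative f'' (p + s *\<^sub>R u + t *\<^sub>R v)) (at (p + s *\<^sub>R u + t *\<^sub>R v))"
  obtains s t where "0 < s" "s < h" "0 < t" "t < h"
    "f (p + h *\<^sub>R u + h *\<^sub>R v) - f (p + h *\<^sub>R u) - f (p + h *\<^sub>R v) + f p = h * (h * f'' (p + s *\<^sub>R u + t *\<^sub>R v) v)"
proof -
  let ?q = "\<lambda>s t. p + s *\<^sub>R u + t *\<^sub>R v"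
  have s_dir: "((\<lambda>s. f (?q s t)) has_real_derivative f' (?q s t) u) (at s)"
    if "0 \<le> s" "s \<le> h" "0 \<le> t" "t \<le> h" for s t
  proof -
    have "((\<lambda>s. ?q s t) has_derivative (\<lambda>k. k *\<^sub>R u)) (at s)"
      by (auto intro!: derivative_eq_intros)
    from has_derivative_compose[OF this f'[OF that]]
    show ?thesis
      using linear_cmul[OF has_derivative_linear[OF f'[OF that]]]
      by (simp add: has_field_derivative_def mult_commute_abs)
  qed
  have t_dir: "((\<lambda>t. f' (?q s t) u) has_real_derivative f'' (?q s t) v) (at t)"
    if "0 \<le> s" "s \<le> h" "0 \<le> t" "t \<le> h" for s t
  proof -
    have "((\<lambda>t. ?q s t) has_derivative (\<lambda>k. k *\<^sub>R v)) (at t)"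
      by (auto intro!: derivative_eq_intros)
    from has_derivative_compose[OF this f''[OF that]]
    show ?thesis
      using linear_cmul[OF has_derivative_linear[OF f''[OF that]]]
      by (simp add: has_field_derivative_def mult_commute_abs)
  qed
  have "\<exists>s. 0 < s \<and> s < h \<and> (f (?q h h) - f (?q h 0)) - (f (?q 0 h) - f (?q 0 0))
      = (h - 0) * (f' (?q s h) u - f' (?q s 0) u)"
    by (rule MVT2[OF h]) (use h in \<open>intro DERIV_diff s_dir; simp\<close>)
  then obtain s where s: "0 < s" "s < h"
    "(f (?q h h) - f (?q h 0)) - (f (?q 0 h) - f (?q 0 0)) = h * (f' (?q s h) u - f' (?q s 0) u)"
    by auto
  have "\<exists>t. 0 < t \<and> t < h \<and> f' (?q s h) u - f' (?q s 0) u = (h - 0) * f'' (?q s t) v"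
    by (rule MVT2[OF h]) (use h s in \<open>intro t_dir; simp\<close>)
  then obtain t where "0 < t" "t < h" "f' (?q s h) u - f' (?q s 0) u = h * f'' (?q s t) v" by auto
  then show ?thesis using s by (intro that[of s t]) simp_all
qed

text \<open>Taken in both orders, the same second difference equals h^2 times either mixed
  derivative at a point near \<open>p\<close>. With \<epsilon> half the alleged gap, continuity at
  \<open>p\<close> contradicts the equality of these two values.\<close>

lemma symmetric_second_derivative_real:
  fixes f :: "'a::real_normed_vector \<Rightarrow> real"
  assumes U: "open U" "p \<in> U"
    and f': "\<And>x. x \<in> U \<Longrightarrow> (f has_derivative f' x) (at x)"
    and f'': "\<And>x u. x \<in> U \<Longrightarrow> ((\<lambda>x. f' x u) has_derivative f'' u x) (at x)"
    and cont: "\<And>u v. continuous_on U (\<lambda>x. f'' u x v)"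
  shows "f'' u p v = f'' v p u"
proof (rule ccontr)
  assume "f'' u p v \<noteq> f'' v p u"
  define \<epsilon> where "\<epsilon> = \<bar>f'' u p v - f'' v p u\<bar> / 2"
  have \<epsilon>: "\<epsilon> > 0" using \<open>f'' u p v \<noteq> f'' v p u\<close> by (simp add: \<epsilon>_def)
  obtain d where d: "d > 0" "ball p d \<subseteq> U" using U open_contains_ball by blast
  obtain d1 where d1: "d1 > 0" "\<And>x. x \<in> U \<Longrightarrow> dist x p < d1 \<Longrightarrow> dist (f'' u x v) (f'' u p v) < \<epsilon>"
    using cont[of u v] U(2) \<epsilon> unfolding continuous_on_iff by metis
  obtain d2 where d2: "d2 > 0" "\<And>x. x \<in> U \<Longrightarrow> dist x p < d2 \<Longrightarrow> dist (f'' v x u) (f'' v p u) < \<epsilon>"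
    using cont[of v u] U(2) \<epsilon> unfolding continuous_on_iff by metis
  \<comment> \<open>The summand 1 keeps \<open>K\<close> positive and makes the estimate below
    strict, even for u = v = 0.\<close>
  define K where "K = norm u + norm v + 1"
  define h where "h = min d (min d1 d2) / K"
  have K: "K > 0" unfolding K_def by (simp add: add_nonneg_pos)
  have h: "h > 0" using d d1 d2 K by (simp add: h_def)
  have near: "dist (p + s *\<^sub>R u + t *\<^sub>R v) p < min d (min d1 d2)"
    if "0 \<le> s" "s \<le> h" "0 \<le> t" "t \<le> h" for s t
  proof -
    have "dist (p + s *\<^sub>R u + t *\<^sub>R v) p \<le> s * norm u + t * norm v"
      using that norm_triangle_ineq[of "s *\<^sub>R u" "t *\<^sub>R v"] by (simp add: dist_norm)
    also have "\<dots> \<le> h * norm u + h * norm v"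
      using that by (intro add_mono mult_right_mono) auto
    also have "\<dots> < h * K" using h by (simp add: K_def algebra_simps)
    also have "\<dots> = min d (min d1 d2)" using K by (simp add: h_def)
    finally show ?thesis .
  qed
  have inU: "p + s *\<^sub>R u + t *\<^sub>R v \<in> U" if "0 \<le> s" "s \<le> h" "0 \<le> t" "t \<le> h" for s t
    using near[OF that] d by (auto simp: dist_commute)
  have swap: "p + s *\<^sub>R v + t *\<^sub>R u = p + t *\<^sub>R u + s *\<^sub>R v" for s t by simp
  obtain s t where st: "0 < s" "s < h" "0 < t" "t < h"
    "f (p + h *\<^sub>R u + h *\<^sub>R v) - f (p + h *\<^sub>R u) - f (p + h *\<^sub>R v) + f p
      = h * (h * f'' u (p + s *\<^sub>R u + t *\<^sub>R v) v)"
    by (rule second_difference_mean_value[where u = u and v = v and p = p, OF h f' f'']) (rule inU; assumption)+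
  obtain s' t' where st': "0 < s'" "s' < h" "0 < t'" "t' < h"
    "f (p + h *\<^sub>R v + h *\<^sub>R u) - f (p + h *\<^sub>R v) - f (p + h *\<^sub>R u) + f p
      = h * (h * f'' v (p + s' *\<^sub>R v + t' *\<^sub>R u) u)"
    by (rule second_difference_mean_value[where u = v and v = u and p = p, OF h f' f'']) (subst swap, rule inU; assumption)+
  have "h * (h * f'' u (p + s *\<^sub>R u + t *\<^sub>R v) v) = h * (h * f'' v (p + t' *\<^sub>R u + s' *\<^sub>R v) u)"
    using st(5) st'(5) unfolding swap by linarith
  then have "f'' u (p + s *\<^sub>R u + t *\<^sub>R v) v = f'' v (p + t' *\<^sub>R u + s' *\<^sub>R v) u"
    using h by simp
  moreover have "dist (f'' u (p + s *\<^sub>R u + t *\<^sub>R v) v) (f'' u p v) < \<epsilon>"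
    using near[of s t] inU[of s t] st by (intro d1) simp_all
  moreover have "dist (f'' v (p + t' *\<^sub>R u + s' *\<^sub>R v) u) (f'' v p u) < \<epsilon>"
    using near[of t' s'] inU[of t' s'] st' by (intro d2) simp_all
  ultimately show False unfolding \<epsilon>_def dist_real_def by (simp add: abs_if split: if_splits)
qed

lemma smooth_on_symmetric_second_derivative:
  fixes f :: "'a::real_normed_vector \<Rightarrow> 'b::euclidean_space"
  assumes U: "open U" "p \<in> U" and f: "smooth_on U f"
  shows "frechet_derivative (\<lambda>x. frechet_derivative f (at x) u) (at p) v
    = frechet_derivative (\<lambda>x. frechet_derivative f (at x) v) (at p) u"
proof (rule euclidean_eqI)
  fix b :: 'b assume "b \<in> Basis"
  let ?f'' = "\<lambda>u x v. frechet_derivative (\<lambda>x. frechet_derivative f (at x) u) (at x) v"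
  show "?f'' u p v \<bullet> b = ?f'' v p u \<bullet> b"
  proof (rule symmetric_second_derivative_real[OF U])
    show "((\<lambda>x. f x \<bullet> b) has_derivative (\<lambda>u. frechet_derivative f (at x) u \<bullet> b)) (at x)" if "x \<in> U" for x
      using smooth_on_has_derivative[OF f that] by (rule has_derivative_inner_left)
    show "((\<lambda>x. frechet_derivative f (at x) u \<bullet> b) has_derivative (\<lambda>v. ?f'' u x v \<bullet> b)) (at x)"
      if "x \<in> U" for x u
      using smooth_on_has_derivative[OF smooth_on_frechet[OF f] that] by (rule has_derivative_inner_left)
    show "continuous_on U (\<lambda>x. ?f'' u x v \<bullet> b)" for u v
      using smooth_on_continuous_on[OF smooth_on_frechet[OF smooth_on_frechet[OF f]]]
      by (rule continuous_on_inner[OF _ continuous_on_const])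
  qed
qed

text \<open>A product rule when \<open>L\<close> is known to be differentiable only for each fixed
  argument: the moving argument is expanded in \<open>Basis\<close>. Linearity near \<open>x\<close>
  suffices, as for the differential of a map defined on \<open>U\<close>.\<close>

lemma linear_chain:
  fixes L :: "'c::real_normed_vector \<Rightarrow> 'a::euclidean_space \<Rightarrow> 'b::real_normed_vector"
  assumes lin: "linear (L x)" "\<And>y. y \<in> U \<Longrightarrow> linear (L y)" "\<And>h. linear (dL h)" and U: "open U" "x \<in> U"
    and dL: "\<And>u. ((\<lambda>x. L x u) has_derivative (\<lambda>h. dL h u)) (at x)"
    and a: "(a has_derivative a') (at x)"
  shows "((\<lambda>x. L x (a x)) has_derivative (\<lambda>h. dL h (a x) + L x (a' h))) (at x)"
proof -
  have "((\<lambda>y. \<Sum>b\<in>Basis. (a y \<bullet> b) *\<^sub>R L y b) has_derivative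
      (\<lambda>h. \<Sum>b\<in>Basis. (a x \<bullet> b) *\<^sub>R dL h b + (a' h \<bullet> b) *\<^sub>R L x b)) (at x)"
    by (intro has_derivative_sum has_derivative_scaleR has_derivative_inner_left a dL)
  also have "(\<lambda>h. \<Sum>b\<in>Basis. (a x \<bullet> b) *\<^sub>R dL h b + (a' h \<bullet> b) *\<^sub>R L x b)
      = (\<lambda>h. dL h (a x) + L x (a' h))"
    unfolding sum.distrib linear_basis_expansion[OF lin(1), symmetric]
      linear_basis_expansion[OF lin(3), symmetric] ..
  finally show ?thesis
    by (rule has_derivative_transform_within_open[OF _ U])
      (simp add: linear_basis_expansion[OF lin(2), symmetric])
qed

lemma bilinear_chain:
  fixes B :: "'a::euclidean_space \<Rightarrow> 'a \<Rightarrow> 'a \<Rightarrow> 'b::real_normed_vector"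
  assumes lin: "\<And>p. bilinear (B p)" "\<And>h. bilinear (dB h)"
    and dB: "\<And>u v. ((\<lambda>p. B p u v) has_derivative (\<lambda>h. dB h u v)) (at (\<phi> x))"
    and \<phi>: "(\<phi> has_derivative \<phi>') (at x)" and a: "(a has_derivative a') (at x)"
    and b: "(b has_derivative b') (at x)"
  shows "((\<lambda>x. B (\<phi> x) (a x) (b x)) has_derivative
    (\<lambda>h. dB (\<phi>' h) (a x) (b x) + B (\<phi> x) (a' h) (b x) + B (\<phi> x) (a x) (b' h))) (at x)"
proof -
  have l: "linear (B p u)" "linear (\<lambda>u. B p u v)" "linear (dB h u)" "linear (\<lambda>u. dB h u v)" for p h u v
    using lin unfolding bilinear_def by auto
  have "((\<lambda>x. B (\<phi> x) u (b x)) has_derivative (\<lambda>h. dB (\<phi>' h) u (b x) + B (\<phi> x) u (b' h))) (at x)" for u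
    by (rule linear_chain[where L = "\<lambda>x. B (\<phi> x) u" and dL = "\<lambda>h. dB (\<phi>' h) u" and U = UNIV])
      (use l has_derivative_compose[OF \<phi> dB] b in auto)
  note inner = this
  have "((\<lambda>x. B (\<phi> x) (a x) (b x)) has_derivative
    (\<lambda>h. (dB (\<phi>' h) (a x) (b x) + B (\<phi> x) (a x) (b' h)) + B (\<phi> x) (a' h) (b x))) (at x)"
    by (rule linear_chain[where L = "\<lambda>x u. B (\<phi> x) u (b x)"
          and dL = "\<lambda>h u. dB (\<phi>' h) u (b x) + B (\<phi> x) u (b' h)" and U = UNIV])
      (use l inner a in \<open>auto intro: linear_compose_add\<close>)
  then show ?thesis by (simp add: ac_simps)
qed

section \<open>Equivariance of the curvature under isometries\<close>

text \<open>\<open>B\<close> is L A L^-1. The coordinate basis need not be mapped to itself, so the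
  sums agree only as traces.\<close>

lemma trace_conjugate:
  fixes L A B :: "real^'n \<Rightarrow> real^'n"
  assumes L: "linear L" "bij L" and A: "linear A" and B: "linear B" and eq: "\<And>w. B (L w) = L (A w)"
  shows "(\<Sum>i\<in>UNIV. B (axis i 1) $ i) = (\<Sum>i\<in>UNIV. A (axis i 1) $ i)"
proof -
  define L' where "L' = inv L"
  have inv: "L' (L x) = x" "L (L' x) = x" for x
    using L(2) by (simp_all add: L'_def bij_is_inj bij_is_surj surj_f_inv_f)
  have L': "linear L'"
    unfolding L'_def using inj_linear_imp_inv_linear[OF L(1)] L(2) bij_is_inj by blast
  have tr: "(\<Sum>i\<in>UNIV. f (axis i 1) $ i) = trace (matrix f)" for f :: "real^'n \<Rightarrow> real^'n"
    by (simp add: trace_def matrix_def)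
  have "B = L \<circ> (A \<circ> L')" using eq inv(2) by (simp add: fun_eq_iff) metis
  then have "matrix B = matrix L ** (matrix A ** matrix L')"
    by (simp add: matrix_compose linear_compose A L(1) L')
  then have "trace (matrix B) = trace ((matrix A ** matrix L') ** matrix L)"
    using trace_mul_sym[of "matrix L" "matrix A ** matrix L'"] by simp
  also have "(matrix A ** matrix L') ** matrix L = matrix (A \<circ> (L' \<circ> L))"
    by (simp add: matrix_compose linear_compose A L(1) L' matrix_mul_assoc)
  also have "A \<circ> (L' \<circ> L) = A" using inv(1) by (simp add: fun_eq_iff)
  finally show ?thesis unfolding tr .
qed

text \<open>\<Gamma> is the Levi-Civita connection of \<open>g\<close>, pinned down by the Koszul
  formula for constant vector fields. The derivatives of \<open>g\<close> and \<Gamma> are explicit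
  data, so that their bilinearity holds at every point, inside \<open>M\<close> or not.\<close>

locale levi_civita =
  fixes M :: "(real^4) set" and g :: metric_field
    and dg :: "real^4 \<Rightarrow> real^4 \<Rightarrow> real^4 \<Rightarrow> real^4 \<Rightarrow> real"
    and \<Gamma> :: "real^4 \<Rightarrow> real^4 \<Rightarrow> real^4 \<Rightarrow> real^4"
    and d\<Gamma> :: "real^4 \<Rightarrow> real^4 \<Rightarrow> real^4 \<Rightarrow> real^4 \<Rightarrow> real^4"
  assumes g_bilinear: "bilinear (g p)" and dg_bilinear: "bilinear (dg p h)"
    and \<Gamma>_bilinear: "bilinear (\<Gamma> p)" and d\<Gamma>_bilinear: "bilinear (d\<Gamma> p h)"
    and g_sym: "g p u v = g p v u" and \<Gamma>_sym: "\<Gamma> p u v = \<Gamma> p v u"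
    and g_nondegenerate: "p \<in> M \<Longrightarrow> (\<And>v. g p u v = 0) \<Longrightarrow> u = 0"
    and dg: "p \<in> M \<Longrightarrow> ((\<lambda>p. g p u v) has_derivative (\<lambda>h. dg p h u v)) (at p)"
    and d\<Gamma>: "p \<in> M \<Longrightarrow> ((\<lambda>p. \<Gamma> p u v) has_derivative (\<lambda>h. d\<Gamma> p h u v)) (at p)"
    and koszul: "p \<in> M \<Longrightarrow> 2 * g p (\<Gamma> p u v) w = dg p u v w + dg p v u w - dg p w u v"
begin

text \<open>The curvature R(w,v)u evaluated on constant vector fields; \<open>Ric\<close> below is
  its trace over \<open>w\<close>.\<close>

definition R :: "real^4 \<Rightarrow> real^4 \<Rightarrow> real^4 \<Rightarrow> real^4 \<Rightarrow> real^4" where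
  "R p w v u = d\<Gamma> p w u v - d\<Gamma> p v u w + \<Gamma> p (\<Gamma> p u v) w - \<Gamma> p (\<Gamma> p u w) v"

definition Ric :: "real^4 \<Rightarrow> real^4 \<Rightarrow> real^4 \<Rightarrow> real" where
  "Ric p u v = (\<Sum>i\<in>UNIV. R p (axis i 1) v u $ i)"

lemma tensor_linear:
  "linear (g p u)" "linear (\<lambda>u. g p u v)" "linear (dg p h u)" "linear (\<lambda>u. dg p h u v)"
  "linear (\<Gamma> p u)" "linear (\<lambda>u. \<Gamma> p u v)" "linear (d\<Gamma> p h u)" "linear (\<lambda>u. d\<Gamma> p h u v)"
  using g_bilinear dg_bilinear \<Gamma>_bilinear d\<Gamma>_bilinear unfolding bilinear_def by auto

lemma g_eqI: "p \<in> M \<Longrightarrow> (\<And>v. g p u v = g p u' v) \<Longrightarrow> u = u'"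
  using g_nondegenerate[of p "u - u'"] linear_diff[OF tensor_linear(2)] by simp

lemma linear_R: "p \<in> M \<Longrightarrow> linear (\<lambda>w. R p w v u)"
proof -
  assume p: "p \<in> M"
  have "linear (\<lambda>w. d\<Gamma> p w u v)" using has_derivative_linear[OF d\<Gamma>[OF p]] .
  then show ?thesis
    unfolding R_def
    by (intro linear_compose_add linear_compose_sub tensor_linear linear_compose[OF tensor_linear(5) tensor_linear(6), unfolded o_def])
qed

context
  fixes U :: "(real^4) set" and \<phi> :: "real^4 \<Rightarrow> real^4"
  assumes U: "open U" "U \<subseteq> M" "\<phi> ` U \<subseteq> M" and \<phi>: "smooth_on U \<phi>" and iso: "preserves_metric g U \<phi>"
begin

abbreviation d1 where "d1 x u \<equiv> frechet_derivative \<phi> (at x) u"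
abbreviation d2 where "d2 x u v \<equiv> frechet_derivative (\<lambda>x. d1 x u) (at x) v"

lemma has_d1: "x \<in> U \<Longrightarrow> (\<phi> has_derivative d1 x) (at x)"
  by (rule smooth_on_has_derivative[OF \<phi>])

lemma has_d2: "x \<in> U \<Longrightarrow> ((\<lambda>x. d1 x u) has_derivative d2 x u) (at x)"
  by (rule smooth_on_has_derivative[OF smooth_on_frechet[OF \<phi>]])

lemma d2_sym: "x \<in> U \<Longrightarrow> d2 x u v = d2 x v u"
  by (rule smooth_on_symmetric_second_derivative[OF U(1) _ \<phi>])

lemma linear_d1: "x \<in> U \<Longrightarrow> linear (d1 x)"
  using has_derivative_linear[OF has_d1] .

lemma linear_d2: "x \<in> U \<Longrightarrow> linear (d2 x u)" "x \<in> U \<Longrightarrow> linear (\<lambda>u. d2 x u v)"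
proof -
  show *: "linear (d2 x u)" if "x \<in> U" for u using has_derivative_linear[OF has_d2[OF that]] .
  show "linear (\<lambda>u. d2 x u v)" if "x \<in> U" using *[OF that, of v] d2_sym[OF that, of _ v] by simp
qed

lemma g_d1: "x \<in> U \<Longrightarrow> g (\<phi> x) (d1 x u) (d1 x v) = g x u v"
  using iso unfolding preserves_metric_def Let_def by blast

lemma bij_d1: assumes x: "x \<in> U" shows "bij (d1 x)"
proof -
  have "u = 0" if "d1 x u = 0" for u
  proof (rule g_nondegenerate)
    show "x \<in> M" using x U by blast
    show "g x u v = 0" for v
      using g_d1[OF x, of u v] that linear_0[OF tensor_linear(2)] by simp
  qed
  then have "inj (d1 x)" using linear_injective_0[OF linear_d1[OF x]] by blast
  then show ?thesis
    using linear_injective_imp_surjective[OF linear_d1[OF x]] by (simp add: bij_def)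
qed

lemma differentiated_isometry:
  assumes x: "x \<in> U"
  shows "dg (\<phi> x) (d1 x h) (d1 x u) (d1 x v) + g (\<phi> x) (d2 x u h) (d1 x v) + g (\<phi> x) (d1 x u) (d2 x v h)
    = dg x h u v"
proof -
  have x': "x \<in> M" "\<phi> x \<in> M" using x U by auto
  have 1: "((\<lambda>x. g (\<phi> x) (d1 x u) (d1 x v)) has_derivative
      (\<lambda>h. dg (\<phi> x) (d1 x h) (d1 x u) (d1 x v) + g (\<phi> x) (d2 x u h) (d1 x v) + g (\<phi> x) (d1 x u) (d2 x v h))) (at x)"
    using x x' by (intro bilinear_chain g_bilinear dg_bilinear dg has_d1 has_d2)
  have 2: "((\<lambda>x. g (\<phi> x) (d1 x u) (d1 x v)) has_derivative (\<lambda>h. dg x h u v)) (at x)"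
    by (rule has_derivative_transform_within_open[OF dg[OF x'(1)] U(1) x]) (simp add: g_d1)
  show ?thesis using fun_cong[OF has_derivative_unique[OF 1 2], of h] .
qed

text \<open>The transformation law of Christoffel symbols. In the Koszul combination of three
  differentiated isometry equations, symmetry of second derivatives cancels all second-derivative
  terms except twice the wanted one.\<close>

lemma d2_eq:
  assumes x: "x \<in> U"
  shows "d2 x u v = d1 x (\<Gamma> x u v) - \<Gamma> (\<phi> x) (d1 x u) (d1 x v)"
proof (rule g_eqI)
  have x': "x \<in> M" using x U by auto
  show \<phi>x: "\<phi> x \<in> M" using x U by auto
  fix w
  obtain w' where w: "w = d1 x w'" using bij_d1[OF x] by (metis bij_pointE)
  have "2 * g (\<phi> x) (d2 x u v) w = 2 * g x (\<Gamma> x u v) w' - 2 * g (\<phi> x) (\<Gamma> (\<phi> x) (d1 x u) (d1 x v)) w"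
    unfolding w koszul[OF x'] koszul[OF \<phi>x] differentiated_isometry[OF x, symmetric]
    using d2_sym[OF x] g_sym by simp
  then show "g (\<phi> x) (d2 x u v) w = g (\<phi> x) (d1 x (\<Gamma> x u v) - \<Gamma> (\<phi> x) (d1 x u) (d1 x v)) w"
    unfolding w linear_diff[OF tensor_linear(2)] g_d1[OF x] by simp
qed

text \<open>Integrability of the transformation law: differentiating \<open>d2_eq\<close> once more
  expresses third derivatives of \<phi>, and their symmetry in \<open>v\<close> and \<open>w\<close>
  is exactly the equivariance of curvature.\<close>

lemma R_equivariant:
  assumes x: "x \<in> U"
  shows "d1 x (R x w v u) = R (\<phi> x) (d1 x w) (d1 x v) (d1 x u)"
proof -
  have x': "x \<in> M" "\<phi> x \<in> M" using x U by auto
  let ?d3 = "\<lambda>v w. frechet_derivative (\<lambda>x. d2 x u v) (at x) w"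
  have d3: "?d3 v w = (d2 x (\<Gamma> x u v) w + d1 x (d\<Gamma> x w u v))
      - (d\<Gamma> (\<phi> x) (d1 x w) (d1 x u) (d1 x v) + \<Gamma> (\<phi> x) (d2 x u w) (d1 x v) + \<Gamma> (\<phi> x) (d1 x u) (d2 x v w))"
    for v w
  proof -
    have "((\<lambda>x. d1 x (\<Gamma> x u v)) has_derivative (\<lambda>h. d2 x (\<Gamma> x u v) h + d1 x (d\<Gamma> x h u v))) (at x)"
      by (rule linear_chain[where L = d1 and U = U and dL = "\<lambda>h u. d2 x u h"])
        (use x x' U linear_d1 linear_d2 has_d2 d\<Gamma> in auto)
    moreover have "((\<lambda>x. \<Gamma> (\<phi> x) (d1 x u) (d1 x v)) has_derivative
      (\<lambda>h. d\<Gamma> (\<phi> x) (d1 x h) (d1 x u) (d1 x v) + \<Gamma> (\<phi> x) (d2 x u h) (d1 x v) + \<Gamma> (\<phi> x) (d1 x u) (d2 x v h))) (at x)"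
      using x x' by (intro bilinear_chain \<Gamma>_bilinear d\<Gamma>_bilinear d\<Gamma> has_d1 has_d2)
    ultimately have "((\<lambda>x. d1 x (\<Gamma> x u v) - \<Gamma> (\<phi> x) (d1 x u) (d1 x v)) has_derivative
      (\<lambda>w. (d2 x (\<Gamma> x u v) w + d1 x (d\<Gamma> x w u v))
      - (d\<Gamma> (\<phi> x) (d1 x w) (d1 x u) (d1 x v) + \<Gamma> (\<phi> x) (d2 x u w) (d1 x v) + \<Gamma> (\<phi> x) (d1 x u) (d2 x v w)))) (at x)"
      by (rule has_derivative_diff)
    then have 3: "((\<lambda>x. d2 x u v) has_derivative
      (\<lambda>w. (d2 x (\<Gamma> x u v) w + d1 x (d\<Gamma> x w u v))
      - (d\<Gamma> (\<phi> x) (d1 x w) (d1 x u) (d1 x v) + \<Gamma> (\<phi> x) (d2 x u w) (d1 x v) + \<Gamma> (\<phi> x) (d1 x u) (d2 x v w)))) (at x)"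
      by (rule has_derivative_transform_within_open[OF _ U(1) x]) (simp add: d2_eq)
    show ?thesis using fun_cong[OF frechet_derivative_at[OF 3], of w] by simp
  qed
  have "?d3 v w = ?d3 w v"
    by (rule smooth_on_symmetric_second_derivative[OF U(1) x smooth_on_frechet[OF \<phi>]])
  then have "d2 x (\<Gamma> x u v) w + d1 x (d\<Gamma> x w u v) - d\<Gamma> (\<phi> x) (d1 x w) (d1 x u) (d1 x v) - \<Gamma> (\<phi> x) (d2 x u w) (d1 x v)
    = d2 x (\<Gamma> x u w) v + d1 x (d\<Gamma> x v u w) - d\<Gamma> (\<phi> x) (d1 x v) (d1 x u) (d1 x w) - \<Gamma> (\<phi> x) (d2 x u v) (d1 x w)"
    unfolding d3 d2_sym[OF x, of w v] by (simp add: algebra_simps)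
  then show ?thesis
    unfolding R_def d2_eq[OF x] linear_diff[OF linear_d1[OF x]] linear_add[OF linear_d1[OF x]]
      linear_diff[OF tensor_linear(6)]
    using \<Gamma>_sym[of "\<phi> x"] by (simp add: algebra_simps)
qed

lemma Ric_invariant:
  assumes x: "x \<in> U"
  shows "Ric (\<phi> x) (d1 x u) (d1 x v) = Ric x u v"
  unfolding Ric_def
  by (rule trace_conjugate[where L = "d1 x" and A = "\<lambda>w. R x w v u"])
    (use x U in \<open>auto intro!: linear_d1 bij_d1 linear_R simp: R_equivariant\<close>)

lemma Ricci_operator_equivariant:
  assumes Q: "\<And>p u v. p \<in> M \<Longrightarrow> g p (Q p u) v = Ric p u v" and x: "x \<in> U"
  shows "Q (\<phi> x) (d1 x u) = d1 x (Q x u)"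
proof (rule g_eqI)
  have x': "x \<in> M" using x U by auto
  show \<phi>x: "\<phi> x \<in> M" using x U by auto
  fix v
  obtain v' where v: "v = d1 x v'" using bij_d1[OF x] by (metis bij_pointE)
  show "g (\<phi> x) (Q (\<phi> x) (d1 x u)) v = g (\<phi> x) (d1 x (Q x u)) v"
    unfolding v g_d1[OF x] Q[OF x'] Q[OF \<phi>x] by (rule Ric_invariant[OF x])
qed

end

end

section \<open>The Ricci tensor of a Goedel-type metric\<close>

text \<open>The metric depends on \<open>x\<close> alone; this is its \<open>x\<close>-derivative,
  with H' written as \<open>f * d\<close>.\<close>

definition goedel_dmetric :: "real \<Rightarrow> real \<Rightarrow> real \<Rightarrow> real \<Rightarrow> real^4 \<Rightarrow> real^4 \<Rightarrow> real" where
  "goedel_dmetric h f d d1 u v =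
     f * d * (u $ 3 * (v $ 1 + h * v $ 3) + (u $ 1 + h * u $ 3) * v $ 3) - 2 * d * d1 * u $ 3 * v $ 3"

text \<open>Component \<open>dt + H dy\<close> and the components \<open>x\<close>, \<open>y\<close> of the Christoffel symbols, as functions of
  \<open>h = H\<close>, \<open>f = H'/D\<close>, \<open>d = D\<close>, \<open>d1 = D'\<close>, together with their \<open>x\<close>-derivatives (\<open>f1 = f'\<close>, \<open>d2 = D''\<close>).\<close>
definition christoffel_t :: "real \<Rightarrow> real \<Rightarrow> real^4 \<Rightarrow> real^4 \<Rightarrow> real" where
  "christoffel_t f d u v = f * d * (u $ 2 * v $ 3 + v $ 2 * u $ 3) / 2"
definition christoffel_x :: "real \<Rightarrow> real \<Rightarrow> real \<Rightarrow> real \<Rightarrow> real^4 \<Rightarrow> real^4 \<Rightarrow> real" where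
  "christoffel_x h f d d1 u v = goedel_dmetric h f d d1 u v / 2"
definition christoffel_y :: "real \<Rightarrow> real \<Rightarrow> real \<Rightarrow> real \<Rightarrow> real^4 \<Rightarrow> real^4 \<Rightarrow> real" where
  "christoffel_y h f d d1 u v = - (u $ 2 * (f * (v $ 1 + h * v $ 3) - 2 * d1 * v $ 3)
     + v $ 2 * (f * (u $ 1 + h * u $ 3) - 2 * d1 * u $ 3)) / (2 * d)"
definition christoffel_t' :: "real \<Rightarrow> real \<Rightarrow> real \<Rightarrow> real \<Rightarrow> real^4 \<Rightarrow> real^4 \<Rightarrow> real" where
  "christoffel_t' f f1 d d1 u v = (f1 * d + f * d1) * (u $ 2 * v $ 3 + v $ 2 * u $ 3) / 2"
definition christoffel_x' :: "real \<Rightarrow> real \<Rightarrow> real \<Rightarrow> real \<Rightarrow> real \<Rightarrow> real \<Rightarrow> real^4 \<Rightarrow> real^4 \<Rightarrow> real" where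
  "christoffel_x' h f f1 d d1 d2 u v =
     (f1 * d + f * d1) * (u $ 3 * (v $ 1 + h * v $ 3) + (u $ 1 + h * u $ 3) * v $ 3) / 2
     + (f * d)\<^sup>2 * u $ 3 * v $ 3 - (d1\<^sup>2 + d * d2) * u $ 3 * v $ 3"
definition christoffel_y' :: "real \<Rightarrow> real \<Rightarrow> real \<Rightarrow> real \<Rightarrow> real \<Rightarrow> real \<Rightarrow> real^4 \<Rightarrow> real^4 \<Rightarrow> real" where
  "christoffel_y' h f f1 d d1 d2 u v =
     - (u $ 2 * (f1 * (v $ 1 + h * v $ 3) + f\<^sup>2 * d * v $ 3 - 2 * d2 * v $ 3)
      + v $ 2 * (f1 * (u $ 1 + h * u $ 3) + f\<^sup>2 * d * u $ 3 - 2 * d2 * u $ 3)) / (2 * d)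
     - christoffel_y h f d d1 u v * d1 / d"

definition christoffel :: "real \<Rightarrow> real \<Rightarrow> real \<Rightarrow> real \<Rightarrow> real^4 \<Rightarrow> real^4 \<Rightarrow> real^4" where
  "christoffel h f d d1 u v = (christoffel_t f d u v - h * christoffel_y h f d d1 u v) *\<^sub>R axis 1 1
     + christoffel_x h f d d1 u v *\<^sub>R axis 2 1 + christoffel_y h f d d1 u v *\<^sub>R axis 3 1 + 0 *\<^sub>R axis 4 1"

definition dchristoffel :: "real \<Rightarrow> real \<Rightarrow> real \<Rightarrow> real \<Rightarrow> real \<Rightarrow> real \<Rightarrow> real^4 \<Rightarrow> real^4 \<Rightarrow> real^4" where
  "dchristoffel h f f1 d d1 d2 u v =
     (christoffel_t' f f1 d d1 u v - f * d * christoffel_y h f d d1 u v - h * christoffel_y' h f f1 d d1 d2 u v) *\<^sub>R axis 1 1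
     + christoffel_x' h f f1 d d1 d2 u v *\<^sub>R axis 2 1 + christoffel_y' h f f1 d d1 d2 u v *\<^sub>R axis 3 1 + 0 *\<^sub>R axis 4 1"

lemmas christoffel_nth =
  coordinate_axis_sum[of "christoffel_t f d u v - h * christoffel_y h f d d1 u v" "christoffel_x h f d d1 u v" "christoffel_y h f d d1 u v" 0,
    folded christoffel_def] for h f d d1 u v
lemmas dchristoffel_nth =
  coordinate_axis_sum[of "christoffel_t' f f1 d d1 u v - f * d * christoffel_y h f d d1 u v - h * christoffel_y' h f f1 d d1 d2 u v"
      "christoffel_x' h f f1 d d1 d2 u v" "christoffel_y' h f f1 d d1 d2 u v" 0, folded dchristoffel_def] for h f f1 d d1 d2 u v

lemma axis_4_nth:
  "axis 1 (1::real) $ (1::4) = 1" "axis 1 (1::real) $ (2::4) = 0" "axis 1 (1::real) $ (3::4) = 0" "axis 1 (1::real) $ (4::4) = 0"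
  "axis 2 (1::real) $ (1::4) = 0" "axis 2 (1::real) $ (2::4) = 1" "axis 2 (1::real) $ (3::4) = 0" "axis 2 (1::real) $ (4::4) = 0"
  "axis 3 (1::real) $ (1::4) = 0" "axis 3 (1::real) $ (2::4) = 0" "axis 3 (1::real) $ (3::4) = 1" "axis 3 (1::real) $ (4::4) = 0"
  "axis 4 (1::real) $ (1::4) = 0" "axis 4 (1::real) $ (2::4) = 0" "axis 4 (1::real) $ (3::4) = 0" "axis 4 (1::real) $ (4::4) = 1"
  by (simp_all add: axis_def)

text \<open>The sum is the Ricci tensor, whose derivative terms survive only along \<open>x\<close>.
  In the coframe (dt + H dy, dx, D dy, dz) it has entry f^2/2 in time, \<kappa> in \<open>x\<close>
  and \<open>y\<close>, and f'/2 mixing time with \<open>y\<close>.\<close>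

lemma ricci_components:
  fixes h f f1 d d1 d2 :: real
  assumes d: "d \<noteq> 0"
  defines "\<Gamma> \<equiv> christoffel h f d d1" and "\<Gamma>' \<equiv> dchristoffel h f f1 d d1 d2"
  shows "(\<Sum>i\<in>UNIV. (axis i 1 $ 2 *\<^sub>R \<Gamma>' u v - v $ 2 *\<^sub>R \<Gamma>' u (axis i 1)
      + \<Gamma> (\<Gamma> u v) (axis i 1) - \<Gamma> (\<Gamma> u (axis i 1)) v) $ i)
    = f\<^sup>2 / 2 * ((u $ 1 + h * u $ 3) * (v $ 1 + h * v $ 3))
      + f1 / 2 * d * ((u $ 1 + h * u $ 3) * v $ 3 + u $ 3 * (v $ 1 + h * v $ 3))
      + (f\<^sup>2 / 2 - d2 / d) * (u $ 2 * v $ 2 + d\<^sup>2 * u $ 3 * v $ 3)"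
proof -
  note nths = christoffel_nth dchristoffel_nth axis_4_nth vector_add_component vector_minus_component
    vector_scaleR_component real_scaleR_def
  show ?thesis
    unfolding sum_4 \<Gamma>_def \<Gamma>'_def nths christoffel_t_def christoffel_x_def christoffel_y_def christoffel_t'_def christoffel_x'_def christoffel_y'_def goedel_dmetric_def
    using d by (simp add: field_simps power2_eq_square)
qed

text \<open>The Ricci tensor with one index raised: the signature causes the minus signs in
  \<open>x\<close> and \<open>y\<close>, and the terms with factor \<open>h\<close> convert from the
  coframe back to the coordinate \<open>t\<close>.\<close>

definition ricci_operator :: "real \<Rightarrow> real \<Rightarrow> real \<Rightarrow> real \<Rightarrow> real \<Rightarrow> real^4 \<Rightarrow> real^4" where
  "ricci_operator h f f1 d \<kappa> u =
     (f\<^sup>2 / 2 * (u $ 1 + h * u $ 3) + f1 / 2 * d * u $ 3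
       + h * (f1 / 2 * (u $ 1 + h * u $ 3) / d + \<kappa> * u $ 3)) *\<^sub>R axis 1 1
     + (- \<kappa> * u $ 2) *\<^sub>R axis 2 1
     + - (f1 / 2 * (u $ 1 + h * u $ 3) / d + \<kappa> * u $ 3) *\<^sub>R axis 3 1 + 0 *\<^sub>R axis 4 1"

lemmas ricci_operator_nth = coordinate_axis_sum[of "f\<^sup>2 / 2 * (u $ 1 + h * u $ 3) + f1 / 2 * d * u $ 3
       + h * (f1 / 2 * (u $ 1 + h * u $ 3) / d + \<kappa> * u $ 3)" "- \<kappa> * u $ 2"
     "- (f1 / 2 * (u $ 1 + h * u $ 3) / d + \<kappa> * u $ 3)" 0, folded ricci_operator_def]
  for h f f1 d \<kappa> :: real and u :: "real^4"

lemma vec4_eqI: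
  fixes u v :: "'a^4"
  shows "u $ 1 = v $ 1 \<Longrightarrow> u $ 2 = v $ 2 \<Longrightarrow> u $ 3 = v $ 3 \<Longrightarrow> u $ 4 = v $ 4 \<Longrightarrow> u = v"
  by (simp add: vec_eq_iff forall_4)

lemma linear_ricci_operator: "linear (ricci_operator h f f1 d \<kappa>)"
  by (intro linearI vec4_eqI) (simp_all add: ricci_operator_nth algebra_simps add_divide_distrib)

lemma trace_ricci_operator:
  "(\<Sum>i\<in>UNIV. ricci_operator h f f1 d \<kappa> (axis i 1) $ i) = f\<^sup>2 / 2 - 2 * \<kappa>"
  unfolding sum_4 ricci_operator_nth axis_4_nth by simp

lemma ricci_operator_axis_2: "ricci_operator h f f1 d \<kappa> (axis 2 1) = - \<kappa> *\<^sub>R axis 2 1"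
  by (intro vec4_eqI) (simp_all add: ricci_operator_nth axis_4_nth)

lemma finite_ricci_eigenvalues:
  assumes d: "d \<noteq> 0"
  shows "finite {l. \<exists>u. u \<noteq> 0 \<and> ricci_operator h f f1 d \<kappa> u = l *\<^sub>R u}"
proof (rule finite_subset)
  \<comment> \<open>The operator is -\<kappa> on the \<open>x\<close>-axis and 0 on the
    \<open>z\<close>-axis; \<open>?p\<close> is the characteristic polynomial of its remaining 2 by
    2 block, in the components u1 + h u3 and d u3.\<close>
  let ?p = "[:- (f\<^sup>2 / 2 * \<kappa>) + f1\<^sup>2 / 4, \<kappa> - f\<^sup>2 / 2, 1:]"
  show "finite ({0, - \<kappa>} \<union> {l. poly ?p l = 0})"
    by (intro finite_UnI poly_roots_finite) auto
  show "{l. \<exists>u. u \<noteq> 0 \<and> ricci_operator h f f1 d \<kappa> u = l *\<^sub>R u} \<subseteq> {0, - \<kappa>} \<union> {l. poly ?p l = 0}"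
  proof (intro subsetI UnCI CollectI)
    fix l
    assume "l \<in> {l. \<exists>u. u \<noteq> 0 \<and> ricci_operator h f f1 d \<kappa> u = l *\<^sub>R u}"
      and not0: "l \<notin> {l. poly ?p l = 0}"
    then obtain u where u: "u \<noteq> 0" and eig: "ricci_operator h f f1 d \<kappa> u = l *\<^sub>R u" by blast
    show "l \<in> {0, - \<kappa>}"
    proof (rule ccontr)
      assume not: "l \<notin> {0, - \<kappa>}"
      define a where "a = u $ 1 + h * u $ 3"
      define b where "b = d * u $ 3"
      have nth: "ricci_operator h f f1 d \<kappa> u $ i = l * u $ i" for i using eig by simp
      have u24: "u $ 2 = 0" "u $ 4 = 0"
        using nth[of 2] nth[of 4] not mult_right_cancel[of "u $ 2" "- \<kappa>" l]
        unfolding ricci_operator_nth by auto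
      have e3: "- (f1 / 2 * a / d + \<kappa> * u $ 3) = l * u $ 3"
        using nth[of 3] unfolding ricci_operator_nth a_def .
      have e1: "f\<^sup>2 / 2 * a + f1 / 2 * b + h * (f1 / 2 * a / d + \<kappa> * u $ 3) = l * u $ 1"
        using nth[of 1] unfolding ricci_operator_nth a_def b_def by simp
      have B: "- (f1 / 2 * a) = (l + \<kappa>) * b"
        using arg_cong[OF e3, of "\<lambda>t. d * t"] d by (simp add: b_def algebra_simps)
      have A: "f1 / 2 * b = (l - f\<^sup>2 / 2) * a"
        using e1 arg_cong[OF e3, of "\<lambda>t. h * t"] by (simp add: a_def algebra_simps)
      have "poly ?p l * a = 0"
      proof -
        have "(l + \<kappa>) * ((l - f\<^sup>2 / 2) * a) = f1 / 2 * - (f1 / 2 * a)"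
          unfolding A[symmetric] B by simp
        then show ?thesis by (simp add: algebra_simps power2_eq_square)
      qed
      moreover have "poly ?p l * b = 0"
      proof -
        have "(l - f\<^sup>2 / 2) * ((l + \<kappa>) * b) = - (f1 / 2 * (f1 / 2 * b))"
          unfolding A B[symmetric] by simp
        then show ?thesis by (simp add: algebra_simps power2_eq_square)
      qed
      moreover have "a \<noteq> 0 \<or> b \<noteq> 0"
        using u u24 d unfolding a_def b_def by (auto intro: vec4_eqI)
      ultimately show False using not0 by auto
    qed
  qed
qed

lemma goedel_metric_bilinear: "bilinear (goedel_metric H D p)"
  unfolding bilinear_def by (auto intro!: linearI simp: goedel_metric_def algebra_simps)

lemma goedel_metric_nondegenerate:
  assumes D: "D (p $ 2) \<noteq> 0" and u: "\<And>v. goedel_metric H D p u v = 0"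
  shows "u = 0"
proof -
  have "u $ 1 + H (p $ 2) * u $ 3 = 0" using u[of "axis 1 1"] by (simp add: goedel_metric_def axis_4_nth)
  moreover have "u $ 2 = 0" using u[of "axis 2 1"] by (simp add: goedel_metric_def axis_4_nth)
  moreover have "u $ 4 = 0" using u[of "axis 4 1"] by (simp add: goedel_metric_def axis_4_nth)
  ultimately show ?thesis
    using u[of "axis 3 1"] D by (intro vec4_eqI) (auto simp: goedel_metric_def axis_4_nth)
qed

lemma goedel_levi_civita:
  fixes H D :: "real \<Rightarrow> real"
  assumes I: "open I" and H: "smooth_on I H" and D: "smooth_on I D"
    and D0: "\<And>x. x \<in> I \<Longrightarrow> D x \<noteq> 0"
  defines "f \<equiv> \<lambda>x. deriv H x / D x"
  shows "levi_civita (goedel_domain I J) (goedel_metric H D)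
    (\<lambda>p h u v. h $ 2 * goedel_dmetric (H (p $ 2)) (f (p $ 2)) (D (p $ 2)) (deriv D (p $ 2)) u v)
    (\<lambda>p. christoffel (H (p $ 2)) (f (p $ 2)) (D (p $ 2)) (deriv D (p $ 2)))
    (\<lambda>p h u v. h $ 2 *\<^sub>R dchristoffel (H (p $ 2)) (f (p $ 2)) (deriv f (p $ 2)) (D (p $ 2))
      (deriv D (p $ 2)) (deriv (deriv D) (p $ 2)) u v)"
proof -
  have smf: "smooth_on I f"
    unfolding f_def using I H D D0 by (intro smooth_on_divide smooth_on_real_deriv)
  have Hd: "(H has_real_derivative f x * D x) (at x)" and Dd: "(D has_real_derivative deriv D x) (at x)"
    and D'd: "(deriv D has_real_derivative deriv (deriv D) x) (at x)"
    and fd: "(f has_real_derivative deriv f x) (at x)" if x: "x \<in> I" for x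
    using smooth_on_real_deriv(1)[OF I H x] smooth_on_real_deriv(1)[OF I D x]
      smooth_on_real_deriv(1)[OF I smooth_on_real_deriv(2)[OF I D] x] smooth_on_real_deriv(1)[OF I smf x]
      D0[OF x] by (simp_all add: f_def)
  have lift: "((\<lambda>p. F (p $ 2)) has_derivative (\<lambda>h::real^4. h $ 2 * F')) (at p)"
    if "(F has_real_derivative F') (at (p $ 2))" for F F' and p :: "real^4"
    by (rule DERIV_compose_FDERIV[OF that bounded_linear_imp_has_derivative[OF bounded_linear_vec_nth]])
  show ?thesis
  proof
    fix p h u v w :: "real^4"
    show "bilinear (goedel_metric H D p)" by (rule goedel_metric_bilinear)
    show "bilinear (\<lambda>u v. h $ 2 * goedel_dmetric (H (p $ 2)) (f (p $ 2)) (D (p $ 2)) (deriv D (p $ 2)) u v)"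
      unfolding bilinear_def by (auto intro!: linearI simp: goedel_dmetric_def algebra_simps)
    show "bilinear (christoffel (H (p $ 2)) (f (p $ 2)) (D (p $ 2)) (deriv D (p $ 2)))"
      unfolding bilinear_def
      by (auto intro!: linearI vec4_eqI simp: christoffel_nth christoffel_t_def christoffel_x_def christoffel_y_def goedel_dmetric_def
          algebra_simps add_divide_distrib diff_divide_distrib)
    show "bilinear (\<lambda>u v. h $ 2 *\<^sub>R dchristoffel (H (p $ 2)) (f (p $ 2)) (deriv f (p $ 2)) (D (p $ 2))
      (deriv D (p $ 2)) (deriv (deriv D) (p $ 2)) u v)"
      unfolding bilinear_def
      by (auto intro!: linearI vec4_eqI simp: dchristoffel_nth christoffel_t'_def christoffel_x'_def christoffel_y'_def christoffel_y_def
          algebra_simps add_divide_distrib diff_divide_distrib)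
    show "goedel_metric H D p u v = goedel_metric H D p v u" by (simp add: goedel_metric_def)
    show "christoffel (H (p $ 2)) (f (p $ 2)) (D (p $ 2)) (deriv D (p $ 2)) u v
      = christoffel (H (p $ 2)) (f (p $ 2)) (D (p $ 2)) (deriv D (p $ 2)) v u"
      by (intro vec4_eqI) (simp_all add: christoffel_nth christoffel_t_def christoffel_x_def christoffel_y_def goedel_dmetric_def algebra_simps)
    assume "p \<in> goedel_domain I J"
    then have x: "p $ 2 \<in> I" by (simp add: goedel_domain_def)
    show "u = 0" if "\<And>v. goedel_metric H D p u v = 0"
      using goedel_metric_nondegenerate[of D p H u] D0[OF x] that by blast
    have "((\<lambda>p. goedel_metric H D p u v) has_derivative (\<lambda>h. h $ 2 *
      (f (p $ 2) * D (p $ 2) * u $ 3 * (v $ 1 + H (p $ 2) * v $ 3)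
      + (u $ 1 + H (p $ 2) * u $ 3) * (f (p $ 2) * D (p $ 2) * v $ 3)
      - 2 * D (p $ 2) * deriv D (p $ 2) * u $ 3 * v $ 3))) (at p)"
      unfolding goedel_metric_def
      by (rule lift[of "\<lambda>x. (u $ 1 + H x * u $ 3) * (v $ 1 + H x * v $ 3) - (D x)\<^sup>2 * u $ 3 * v $ 3
          - u $ 2 * v $ 2 - u $ 4 * v $ 4"])
        (rule derivative_eq_intros Hd[OF x] Dd[OF x] refl | simp add: algebra_simps)+
    then show "((\<lambda>p. goedel_metric H D p u v) has_derivative (\<lambda>h. h $ 2 *
      goedel_dmetric (H (p $ 2)) (f (p $ 2)) (D (p $ 2)) (deriv D (p $ 2)) u v)) (at p)"
      by (rule has_derivative_eq_rhs) (simp add: goedel_dmetric_def fun_eq_iff algebra_simps)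
    show "2 * goedel_metric H D p (christoffel (H (p $ 2)) (f (p $ 2)) (D (p $ 2)) (deriv D (p $ 2)) u v) w
      = u $ 2 * goedel_dmetric (H (p $ 2)) (f (p $ 2)) (D (p $ 2)) (deriv D (p $ 2)) v w
      + v $ 2 * goedel_dmetric (H (p $ 2)) (f (p $ 2)) (D (p $ 2)) (deriv D (p $ 2)) u w
      - w $ 2 * goedel_dmetric (H (p $ 2)) (f (p $ 2)) (D (p $ 2)) (deriv D (p $ 2)) u v"
      using D0[OF x] unfolding goedel_metric_def christoffel_nth christoffel_t_def christoffel_x_def christoffel_y_def goedel_dmetric_def
      by (simp add: field_simps power2_eq_square)
    have christoffel_t_der: "((\<lambda>x. christoffel_t (f x) (D x) u v) has_real_derivative
        christoffel_t' (f (p $ 2)) (deriv f (p $ 2)) (D (p $ 2)) (deriv D (p $ 2)) u v) (at (p $ 2))"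
      unfolding christoffel_t_def christoffel_t'_def
      by (rule derivative_eq_intros Dd[OF x] fd[OF x] refl | simp add: algebra_simps)+
    have christoffel_x_der: "((\<lambda>x. christoffel_x (H x) (f x) (D x) (deriv D x) u v) has_real_derivative
        christoffel_x' (H (p $ 2)) (f (p $ 2)) (deriv f (p $ 2)) (D (p $ 2)) (deriv D (p $ 2)) (deriv (deriv D) (p $ 2)) u v)
        (at (p $ 2))"
      unfolding christoffel_x_def christoffel_x'_def goedel_dmetric_def
      by (rule derivative_eq_intros Hd[OF x] Dd[OF x] D'd[OF x] fd[OF x] refl
          | simp add: algebra_simps power2_eq_square add_divide_distrib diff_divide_distrib)+
    have christoffel_y_der: "((\<lambda>x. christoffel_y (H x) (f x) (D x) (deriv D x) u v) has_real_derivative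
        christoffel_y' (H (p $ 2)) (f (p $ 2)) (deriv f (p $ 2)) (D (p $ 2)) (deriv D (p $ 2)) (deriv (deriv D) (p $ 2)) u v)
        (at (p $ 2))"
    proof -
      let ?n = "\<lambda>x. - (u $ 2 * (f x * (v $ 1 + H x * v $ 3) - 2 * deriv D x * v $ 3)
         + v $ 2 * (f x * (u $ 1 + H x * u $ 3) - 2 * deriv D x * u $ 3))"
      let ?n' = "- (u $ 2 * (deriv f (p $ 2) * (v $ 1 + H (p $ 2) * v $ 3) + (f (p $ 2))\<^sup>2 * D (p $ 2) * v $ 3
           - 2 * deriv (deriv D) (p $ 2) * v $ 3)
         + v $ 2 * (deriv f (p $ 2) * (u $ 1 + H (p $ 2) * u $ 3) + (f (p $ 2))\<^sup>2 * D (p $ 2) * u $ 3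
           - 2 * deriv (deriv D) (p $ 2) * u $ 3))"
      have "(?n has_real_derivative ?n') (at (p $ 2))"
        by (rule derivative_eq_intros Hd[OF x] Dd[OF x] D'd[OF x] fd[OF x] refl
            | simp add: algebra_simps power2_eq_square)+
      moreover have "((\<lambda>x. 2 * D x) has_real_derivative 2 * deriv D (p $ 2)) (at (p $ 2))"
        by (rule DERIV_cmult[OF Dd[OF x]])
      ultimately have "((\<lambda>x. ?n x / (2 * D x)) has_real_derivative
          (?n' * (2 * D (p $ 2)) - ?n (p $ 2) * (2 * deriv D (p $ 2))) / (2 * D (p $ 2) * (2 * D (p $ 2)))) (at (p $ 2))"
        by (rule DERIV_divide) (use D0[OF x] in simp)
      moreover have "(n' * (2 * d) - n * (2 * d1)) / (2 * d * (2 * d)) = n' / (2 * d) - n / (2 * d) * d1 / d"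
        if "d \<noteq> 0" for n n' d d1 :: real
        using that by (simp add: field_simps)
      ultimately show ?thesis
        unfolding christoffel_y_def christoffel_y'_def using D0[OF x] by simp
    qed
    show "((\<lambda>p. christoffel (H (p $ 2)) (f (p $ 2)) (D (p $ 2)) (deriv D (p $ 2)) u v) has_derivative
      (\<lambda>h. h $ 2 *\<^sub>R dchristoffel (H (p $ 2)) (f (p $ 2)) (deriv f (p $ 2)) (D (p $ 2))
        (deriv D (p $ 2)) (deriv (deriv D) (p $ 2)) u v)) (at p)"
    proof -
      note der = has_derivative_add[OF has_derivative_add[OF has_derivative_add[OF
        has_derivative_scaleR_left[OF lift[OF DERIV_diff[OF christoffel_t_der DERIV_mult[OF Hd[OF x] christoffel_y_der]]], of "axis 1 1"]
        has_derivative_scaleR_left[OF lift[OF christoffel_x_der], of "axis 2 1"]]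
        has_derivative_scaleR_left[OF lift[OF christoffel_y_der], of "axis 3 1"]]
        has_derivative_scaleR_left[OF has_derivative_const[of 0], of "axis 4 1"]]
      show ?thesis
        unfolding christoffel_def[abs_def]
        by (rule has_derivative_eq_rhs[OF der])
          (intro ext vec4_eqI, simp_all add: dchristoffel_nth axis_4_nth algebra_simps)
    qed
  qed
qed

section \<open>Invariants of motions\<close>

text \<open>In the orthonormal frame (axis 1, axis 2, \<open>e2\<close>, axis 4) at
  \<open>p\<close>, torsion sends (axis 2, \<open>e2\<close>) to S(p) times axis 1. If S(p) is
  nonzero, the image \<open>W\<close> of axis 1 is parallel to axis 1 at \<open>q\<close>, and being
  a unit vector it forces t^2 = S(p)^2.\<close>

lemma goedel_torsion_scalar_le:
  assumes L: "linear L" and D0: "D (p $ 2) \<noteq> 0"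
    and iso: "\<And>u v. goedel_metric H D q (L u) (L v) = goedel_metric H D p u v"
    and T: "\<And>u v. goedel_torsion D S q (L u) (L v) = L (goedel_torsion D S p u v)"
  shows "(S (p $ 4))\<^sup>2 \<le> (S (q $ 4))\<^sup>2"
proof (cases "S (p $ 4) = 0")
  case False
  let ?h = "H (p $ 2)" and ?d = "D (p $ 2)"
  define e2 :: "real^4" where "e2 = (- ?h / ?d) *\<^sub>R axis 1 1 + 0 *\<^sub>R axis 2 1 + (1 / ?d) *\<^sub>R axis 3 1 + 0 *\<^sub>R axis 4 1"
  have e2: "e2 $ 1 = - ?h / ?d" "e2 $ 2 = 0" "e2 $ 3 = 1 / ?d" "e2 $ 4 = 0"
    unfolding e2_def by (rule coordinate_axis_sum)+
  define U where "U = L (axis 2 1)"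
  define V where "V = L e2"
  define W where "W = L (axis 1 1)"
  define t where "t = D (q $ 2) * S (q $ 4) * (U $ 2 * V $ 3 - U $ 3 * V $ 2)"
  have "goedel_torsion D S p (axis 2 1) e2 = S (p $ 4) *\<^sub>R axis 1 1"
    using D0 by (intro vec4_eqI) (simp_all add: goedel_torsion_def e2 axis_def)
  then have SW: "S (p $ 4) *\<^sub>R W = axis 1 t"
    using T[of "axis 2 1" e2] linear_cmul[OF L] by (simp add: U_def V_def W_def t_def goedel_torsion_def)
  have "W = (1 / S (p $ 4)) *\<^sub>R axis 1 t"
    unfolding SW[symmetric] using False by simp
  then have W: "W $ 1 = t / S (p $ 4)" "W $ 2 = 0" "W $ 3 = 0" "W $ 4 = 0"
    by (simp_all add: axis_def)
  have "goedel_metric H D q W W = 1"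
    unfolding W_def iso by (simp add: goedel_metric_def axis_4_nth)
  then have t2: "t\<^sup>2 = (S (p $ 4))\<^sup>2" and t0: "t \<noteq> 0"
    using False by (auto simp: goedel_metric_def W power2_eq_square)
  have "goedel_metric H D q W U = 0" "goedel_metric H D q W V = 0"
    unfolding W_def U_def V_def iso using D0 by (simp_all add: goedel_metric_def axis_4_nth e2)
  then have UV0: "U $ 1 + H (q $ 2) * U $ 3 = 0" "V $ 1 + H (q $ 2) * V $ 3 = 0"
    using t0 False by (simp_all add: goedel_metric_def W)
  have gram: "goedel_metric H D q U U = - 1" "goedel_metric H D q V V = - 1" "goedel_metric H D q U V = 0"
    unfolding U_def V_def iso using D0
    by (simp_all add: goedel_metric_def axis_4_nth e2 power2_eq_square)
  \<comment> \<open>\<open>U\<close> and \<open>V\<close> are orthogonal to the time axis, so these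
    are components of two orthonormal spatial vectors. By Lagrange's identity their cross product is
    a unit vector; torsion at \<open>q\<close> sees only its \<open>z\<close>-component, hence an
    inequality.\<close>
  define a1 a2 a3 b1 b2 b3 where "a1 = U $ 2" "a2 = D (q $ 2) * U $ 3" "a3 = U $ 4"
    "b1 = V $ 2" "b2 = D (q $ 2) * V $ 3" "b3 = V $ 4"
  note ab = this
  have "a1\<^sup>2 + a2\<^sup>2 + a3\<^sup>2 = 1" "b1\<^sup>2 + b2\<^sup>2 + b3\<^sup>2 = 1" "a1 * b1 + a2 * b2 + a3 * b3 = 0"
    using gram[unfolded goedel_metric_def UV0] unfolding ab
    by (simp_all add: power2_eq_square algebra_simps)
  moreover have "(a1 * b2 - a2 * b1)\<^sup>2 + (a1 * b3 - a3 * b1)\<^sup>2 + (a2 * b3 - a3 * b2)\<^sup>2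
      = (a1\<^sup>2 + a2\<^sup>2 + a3\<^sup>2) * (b1\<^sup>2 + b2\<^sup>2 + b3\<^sup>2) - (a1 * b1 + a2 * b2 + a3 * b3)\<^sup>2"
    by (simp add: power2_eq_square algebra_simps)
  ultimately have "(a1 * b2 - a2 * b1)\<^sup>2 + (a1 * b3 - a3 * b1)\<^sup>2 + (a2 * b3 - a3 * b2)\<^sup>2 = 1" by simp
  then have "(a1 * b2 - a2 * b1)\<^sup>2 \<le> 1"
    using zero_le_power2[of "a1 * b3 - a3 * b1"] zero_le_power2[of "a2 * b3 - a3 * b2"] by linarith
  moreover have "t = S (q $ 4) * (a1 * b2 - a2 * b1)"
    unfolding t_def ab by (simp add: algebra_simps)
  ultimately have "t\<^sup>2 \<le> (S (q $ 4))\<^sup>2"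
    by (simp add: power_mult_distrib mult_left_le)
  then show ?thesis using t2 by simp
qed simp

lemma goedel_motion_invariants:
  fixes H D S :: "real \<Rightarrow> real"
  assumes I: "open I" and H: "smooth_on I H" and D: "smooth_on I D"
    and D0: "\<And>x. x \<in> I \<Longrightarrow> D x \<noteq> 0"
    and motion: "affine_isometric_motion (goedel_domain I J) (goedel_metric H D) (goedel_torsion D S) U \<phi>"
    and p: "p \<in> U"
  defines "f \<equiv> \<lambda>x. deriv H x / D x" and "\<kappa> \<equiv> \<lambda>x. (deriv H x / D x)\<^sup>2 / 2 - deriv (deriv D) x / D x"
  shows "(f (\<phi> p $ 2))\<^sup>2 / 2 - 2 * \<kappa> (\<phi> p $ 2) = (f (p $ 2))\<^sup>2 / 2 - 2 * \<kappa> (p $ 2)"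
    and "- \<kappa> (\<phi> p $ 2) \<in> {l. \<exists>u. u \<noteq> 0 \<and>
      ricci_operator (H (p $ 2)) (f (p $ 2)) (deriv f (p $ 2)) (D (p $ 2)) (\<kappa> (p $ 2)) u = l *\<^sub>R u}"
    and "(S (\<phi> p $ 4))\<^sup>2 = (S (p $ 4))\<^sup>2"
proof -
  define M where "M = goedel_domain I J"
  interpret levi_civita M "goedel_metric H D"
    "\<lambda>p h u v. h $ 2 * goedel_dmetric (H (p $ 2)) (f (p $ 2)) (D (p $ 2)) (deriv D (p $ 2)) u v"
    "\<lambda>p. christoffel (H (p $ 2)) (f (p $ 2)) (D (p $ 2)) (deriv D (p $ 2))"
    "\<lambda>p h u v. h $ 2 *\<^sub>R dchristoffel (H (p $ 2)) (f (p $ 2)) (deriv f (p $ 2)) (D (p $ 2))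
      (deriv D (p $ 2)) (deriv (deriv D) (p $ 2)) u v"
    unfolding M_def f_def by (rule goedel_levi_civita[OF I H D D0])
  have mot: "open U" "U \<subseteq> M" "\<phi> ` U \<subseteq> M" "smooth_on U \<phi>" "preserves_metric (goedel_metric H D) U \<phi>"
    and tor: "preserves_torsion (goedel_torsion D S) U \<phi>"
    using motion unfolding affine_isometric_motion_def local_diffeomorphism_def M_def by auto
  let ?L = "frechet_derivative \<phi> (at p)"
  let ?Q = "\<lambda>p. ricci_operator (H (p $ 2)) (f (p $ 2)) (deriv f (p $ 2)) (D (p $ 2)) (\<kappa> (p $ 2))"
  have Q: "goedel_metric H D p (?Q p u) v = Ric p u v" if "p \<in> M" for p u v
  proof -
    have d: "D (p $ 2) \<noteq> 0" using that D0 by (simp add: M_def goedel_domain_def)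
    have Ric: "Ric p u v = (f (p $ 2))\<^sup>2 / 2 * ((u $ 1 + H (p $ 2) * u $ 3) * (v $ 1 + H (p $ 2) * v $ 3))
      + deriv f (p $ 2) / 2 * D (p $ 2) * ((u $ 1 + H (p $ 2) * u $ 3) * v $ 3 + u $ 3 * (v $ 1 + H (p $ 2) * v $ 3))
      + \<kappa> (p $ 2) * (u $ 2 * v $ 2 + (D (p $ 2))\<^sup>2 * u $ 3 * v $ 3)"
      unfolding Ric_def R_def \<kappa>_def f_def[symmetric]
      using ricci_components[OF d] unfolding f_def by simp
    show ?thesis
      unfolding Ric goedel_metric_def ricci_operator_nth using d by (simp add: field_simps power2_eq_square)
  qed
  have pM: "p \<in> M" "\<phi> p \<in> M" using p mot by auto
  have L: "linear ?L" "bij ?L" using linear_d1[OF mot p] bij_d1[OF mot p] by auto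
  have LQ: "?Q (\<phi> p) (?L u) = ?L (?Q p u)" for u
    by (rule Ricci_operator_equivariant[OF mot, of ?Q]) (use Q p in auto)
  have "(\<Sum>i\<in>UNIV. ?Q (\<phi> p) (axis i 1) $ i) = (\<Sum>i\<in>UNIV. ?Q p (axis i 1) $ i)"
    by (rule trace_conjugate[OF L linear_ricci_operator linear_ricci_operator LQ])
  then show "(f (\<phi> p $ 2))\<^sup>2 / 2 - 2 * \<kappa> (\<phi> p $ 2) = (f (p $ 2))\<^sup>2 / 2 - 2 * \<kappa> (p $ 2)"
    unfolding trace_ricci_operator .
  \<comment> \<open>The preimage of the \<open>x\<close>-direction at the image point is an
    eigenvector at \<open>p\<close>, though possibly in another direction.\<close>
  obtain u where u: "?L u = axis 2 1" using L(2) by (metis bij_pointE)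
  have "?L (?Q p u) = ?L (- \<kappa> (\<phi> p $ 2) *\<^sub>R u)"
    unfolding LQ[symmetric] u ricci_operator_axis_2 linear_cmul[OF L(1)] ..
  then have "?Q p u = - \<kappa> (\<phi> p $ 2) *\<^sub>R u"
    using L(2) by (simp add: bij_is_inj inj_eq)
  moreover have "u \<noteq> 0" using u linear_0[OF L(1)] by (auto simp: axis_eq_0_iff)
  ultimately show "- \<kappa> (\<phi> p $ 2) \<in> {l. \<exists>u. u \<noteq> 0 \<and> ?Q p u = l *\<^sub>R u}" by blast
  have T: "goedel_torsion D S (\<phi> p) (?L u) (?L v) = ?L (goedel_torsion D S p u v)" for u v
    using tor p unfolding preserves_torsion_def Let_def by blast
  have inv: "?L (inv ?L x) = x" "inv ?L (?L x) = x" for x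
    using L(2) by (simp_all add: bij_is_inj bij_is_surj surj_f_inv_f)
  have "(S (p $ 4))\<^sup>2 \<le> (S (\<phi> p $ 4))\<^sup>2"
    by (rule goedel_torsion_scalar_le[OF L(1), of D p H])
      (use D0 pM g_d1[OF mot p] T in \<open>auto simp: M_def goedel_domain_def\<close>)
  \<comment> \<open>The inequality concerns a linear map between two tangent spaces, so it also
    applies to the inverse of the differential.\<close>
  moreover have "(S (\<phi> p $ 4))\<^sup>2 \<le> (S (p $ 4))\<^sup>2"
  proof (rule goedel_torsion_scalar_le[of "inv ?L" D "\<phi> p" H])
    show "linear (inv ?L)" using inj_linear_imp_inv_linear[OF L(1)] L(2) bij_is_inj by blast
    show "D (\<phi> p $ 2) \<noteq> 0" using D0 pM by (simp add: M_def goedel_domain_def)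
    show "goedel_metric H D p (inv ?L u) (inv ?L v) = goedel_metric H D (\<phi> p) u v" for u v
      using g_d1[OF mot p, of "inv ?L u" "inv ?L v"] by (simp add: inv)
    show "goedel_torsion D S p (inv ?L u) (inv ?L v) = inv ?L (goedel_torsion D S (\<phi> p) u v)" for u v
      using arg_cong[OF T[of "inv ?L u" "inv ?L v"], of "inv ?L"] by (simp add: inv)
  qed
  ultimately show "(S (\<phi> p $ 4))\<^sup>2 = (S (p $ 4))\<^sup>2" by simp
qed

section \<open>From invariants of motions to constant functions\<close>

lemma mem_local_orbit_self:
  assumes "open M" "p \<in> M"
  shows "p \<in> local_orbit M g T p"
proof -
  have id: "smooth_on M (\<lambda>x. x)" by (rule smooth_on_bounded_linear[OF assms(1) bounded_linear_ident])
  have "smooth_on M (inv_into M (\<lambda>x. x))"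
    by (rule smooth_on_cong[OF assms(1) id]) (metis inj_on_id2 inv_into_f_f)
  then have "affine_isometric_motion M g T M (\<lambda>x. x)"
    using assms(1) id
    by (simp add: affine_isometric_motion_def local_diffeomorphism_def preserves_metric_def
        preserves_torsion_def frechet_derivative_ident)
  then show ?thesis
    using assms(2) unfolding local_orbit_def by (intro CollectI exI[of _ "\<lambda>x. x"] exI[of _ M]) simp
qed

lemma locally_constant_on_interval:
  fixes F :: "real \<Rightarrow> real"
  assumes "open I" "is_interval I" "I \<noteq> {}"
    and "\<And>x. x \<in> I \<Longrightarrow> eventually (\<lambda>y. F y = F x) (at x)"
  obtains c where "\<And>x. x \<in> I \<Longrightarrow> F x = c"
proof -
  have "F constant_on I"
  proof (rule locally_constant_imp_constant)
    show "connected I" using assms(2) is_interval_connected by blast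
    fix x assume x: "x \<in> I"
    obtain T where "open T" "x \<in> T" "\<forall>y\<in>T. y \<noteq> x \<longrightarrow> F y = F x"
      using assms(4)[OF x] unfolding eventually_at_topological by auto
    then show "\<exists>T. openin (top_of_set I) T \<and> x \<in> T \<and> (\<forall>y\<in>T. F y = F x)"
      using x by (intro exI[of _ "I \<inter> T"]) auto
  qed
  then show ?thesis using that unfolding constant_on_def by blast
qed

lemma constant_on_interval_if_square_constant:
  fixes F :: "real \<Rightarrow> real"
  assumes "is_interval I" "I \<noteq> {}" "continuous_on I F" "\<And>x. x \<in> I \<Longrightarrow> (F x)\<^sup>2 = c"
  obtains c' where "\<And>x. x \<in> I \<Longrightarrow> F x = c'"
proof -
  have "F x = sqrt c \<or> F x = - sqrt c" if "x \<in> I" for x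
    using real_sqrt_abs[of "F x"] unfolding assms(4)[OF that] by auto
  then have "F ` I \<subseteq> {sqrt c, - sqrt c}" by blast
  then have "finite (F ` I)" by (rule finite_subset) simp
  then have "F constant_on I"
    using continuous_finite_range_constant assms(1,3) is_interval_connected by blast
  then show ?thesis using that unfolding constant_on_def by blast
qed

text \<open>The finitely many values other than \<open>F x\<close> form a closed set, which
  continuity avoids near \<open>x\<close>.\<close>

lemma eventually_constant_if_finite_values:
  fixes F :: "real \<Rightarrow> real"
  assumes "isCont F x" "finite E" "eventually (\<lambda>y. F y \<in> E) (at x)"
  shows "eventually (\<lambda>y. F y = F x) (at x)"
proof -
  have "open (- (E - {F x}))" using assms(2) by (intro open_Compl finite_imp_closed) auto
  then have "eventually (\<lambda>y. F y \<in> - (E - {F x})) (at x)"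
    using assms(1) unfolding isCont_def by (intro topological_tendstoD) auto
  with assms(3) show ?thesis by eventually_elim auto
qed

lemma goedel_locally_homogeneous_imp_constant:
  fixes H D S :: "real \<Rightarrow> real" and I J :: "real set"
  assumes I: "open I" "is_interval I" "I \<noteq> {}" and J: "open J" "is_interval J" "J \<noteq> {}"
    and H: "smooth_on I H" and D: "smooth_on I D" and S: "smooth_on J S"
    and D0: "\<And>x. x \<in> I \<Longrightarrow> D x \<noteq> 0"
    and hom: "locally_homogeneous (goedel_domain I J) (goedel_metric H D) (goedel_torsion D S)"
  shows "(\<exists>\<omega>::real. \<forall>x\<in>I. deriv H x / D x = 2 * \<omega>) \<and>
    (\<exists>m2::real. \<forall>x\<in>I. deriv (deriv D) x / D x = m2) \<and>
    (\<exists>S0::real. \<forall>z\<in>J. S z = S0)"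
proof -
  define M where "M = goedel_domain I J"
  define f where "f x = deriv H x / D x" for x
  define \<kappa> where "\<kappa> x = (deriv H x / D x)\<^sup>2 / 2 - deriv (deriv D) x / D x" for x
  have M: "open M"
  proof -
    have "M = (\<lambda>p. p $ 2) -` I \<inter> (\<lambda>p. p $ 4) -` J" by (auto simp: M_def goedel_domain_def)
    then show ?thesis
      by (simp only:) (intro open_Int open_vimage I(1) J(1) continuous_on_component continuous_on_id)
  qed
  note inv = goedel_motion_invariants[OF I(1) H D D0, of J S, folded M_def f_def \<kappa>_def]
  \<comment> \<open>An open orbit contains all small coordinate displacements of \<open>p\<close>.
    Moving along \<open>z\<close> controls \<open>S\<close>; moving along \<open>x\<close> controls
    \<open>f\<close> and \<kappa>.\<close>
  have near: "eventually (\<lambda>s. \<exists>U \<phi>. p \<in> U \<and> affine_isometric_motion M (goedel_metric H D) (goedel_torsion D S) U \<phi>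
      \<and> \<phi> p = p + s *\<^sub>R e) (at 0)" if p: "p \<in> M" for p e
  proof -
    let ?O = "local_orbit M (goedel_metric H D) (goedel_torsion D S) p"
    have "open ?O" "p \<in> ?O"
      using hom p mem_local_orbit_self[OF M p] unfolding locally_homogeneous_def M_def by auto
    moreover have "((\<lambda>s. p + s *\<^sub>R e) \<longlongrightarrow> p + 0 *\<^sub>R e) (at 0)"
      by (intro tendsto_intros)
    ultimately have "eventually (\<lambda>s. p + s *\<^sub>R e \<in> ?O) (at 0)"
      by (intro topological_tendstoD) auto
    then show ?thesis
      by (rule eventually_mono) (unfold local_orbit_def mem_Collect_eq, metis)
  qed
  obtain x\<^sub>0 z\<^sub>0 where x\<^sub>0: "x\<^sub>0 \<in> I" and z\<^sub>0: "z\<^sub>0 \<in> J" using I J by blast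
  define P where "P x z = 0 *\<^sub>R axis 1 1 + x *\<^sub>R axis 2 1 + 0 *\<^sub>R axis 3 1 + z *\<^sub>R (axis 4 1 :: real^4)" for x z
  have P: "P x z $ 2 = x" "P x z $ 4 = z" for x z
    unfolding P_def by (rule coordinate_axis_sum)+
  have PM: "P x z \<in> M" if "x \<in> I" "z \<in> J" for x z
    using that by (simp add: M_def goedel_domain_def P)
  have S2_loc: "eventually (\<lambda>y. (S y)\<^sup>2 = (S z)\<^sup>2) (at z)" if z: "z \<in> J" for z
    unfolding eventually_at_to_0[of _ z]
    using near[OF PM[OF x\<^sub>0 z], of "axis 4 1"]
  proof eventually_elim
    case (elim s)
    then obtain U \<phi> where "P x\<^sub>0 z \<in> U" "\<phi> (P x\<^sub>0 z) = P x\<^sub>0 z + s *\<^sub>R axis 4 1"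
      "affine_isometric_motion M (goedel_metric H D) (goedel_torsion D S) U \<phi>" by blast
    then show ?case using inv(3)[of U \<phi> "P x\<^sub>0 z"] by (simp add: P axis_4_nth add.commute)
  qed
  obtain s2 where s2: "\<And>z. z \<in> J \<Longrightarrow> (S z)\<^sup>2 = s2"
    using locally_constant_on_interval[OF J S2_loc] by blast
  obtain S0 where S0: "\<And>z. z \<in> J \<Longrightarrow> S z = S0"
    using constant_on_interval_if_square_constant[OF J(2,3) smooth_on_continuous_on[OF S] s2] by blast
  have x_inv: "eventually (\<lambda>y. (f y)\<^sup>2 / 2 - 2 * \<kappa> y = (f x)\<^sup>2 / 2 - 2 * \<kappa> x \<and>
      - \<kappa> y \<in> {l. \<exists>u. u \<noteq> 0 \<and> ricci_operator (H x) (f x) (deriv f x) (D x) (\<kappa> x) u = l *\<^sub>R u}) (at x)"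
    if x: "x \<in> I" for x
    unfolding eventually_at_to_0[of _ x]
    using near[OF PM[OF x z\<^sub>0], of "axis 2 1"]
  proof eventually_elim
    case (elim s)
    then obtain U \<phi> where "P x z\<^sub>0 \<in> U" "\<phi> (P x z\<^sub>0) = P x z\<^sub>0 + s *\<^sub>R axis 2 1"
      "affine_isometric_motion M (goedel_metric H D) (goedel_torsion D S) U \<phi>" by blast
    then show ?case
      using inv(1,2)[of U \<phi> "P x z\<^sub>0"] by (simp add: P axis_4_nth add.commute)
  qed
  have smf: "smooth_on I f"
    unfolding f_def using I(1) H D D0 by (intro smooth_on_divide smooth_on_real_deriv)
  have cont_\<kappa>: "isCont \<kappa> x" if "x \<in> I" for x
  proof -
    have "smooth_on I (\<lambda>x. f x * f x / 2 - deriv (deriv D) x / D x)"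
      using I(1) D D0 smf
      by (intro smooth_on_diff smooth_on_divide smooth_on_mult smooth_on_const smooth_on_real_deriv) auto
    then have "continuous_on I \<kappa>"
      unfolding \<kappa>_def f_def by (auto dest: smooth_on_continuous_on simp: power2_eq_square)
    then show ?thesis using that I(1) by (simp add: continuous_on_eq_continuous_at)
  qed
  have \<kappa>_loc: "eventually (\<lambda>y. \<kappa> y = \<kappa> x) (at x)" if x: "x \<in> I" for x
  proof -
    have "eventually (\<lambda>y. - \<kappa> y = - \<kappa> x) (at x)"
    proof (rule eventually_constant_if_finite_values)
      show "isCont (\<lambda>y. - \<kappa> y) x" using cont_\<kappa>[OF x] by (rule continuous_minus)
      show "eventually (\<lambda>y. - \<kappa> y \<in> {l. \<exists>u. u \<noteq> 0 \<and>
          ricci_operator (H x) (f x) (deriv f x) (D x) (\<kappa> x) u = l *\<^sub>R u}) (at x)"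
        using x_inv[OF x] by eventually_elim blast
    qed (rule finite_ricci_eigenvalues[of "D x", OF D0[OF x]])
    then show ?thesis by simp
  qed
  obtain K where K: "\<And>x. x \<in> I \<Longrightarrow> \<kappa> x = K"
    using locally_constant_on_interval[OF I \<kappa>_loc] by blast
  \<comment> \<open>The trace f^2/2 - 2 \<kappa> is invariant, so constancy of \<kappa> passes to
    f^2.\<close>
  have f2_loc: "eventually (\<lambda>y. (f y)\<^sup>2 = (f x)\<^sup>2) (at x)" if "x \<in> I" for x
    using x_inv[OF that] \<kappa>_loc[OF that] by eventually_elim simp
  obtain f2 where f2: "\<And>x. x \<in> I \<Longrightarrow> (f x)\<^sup>2 = f2"
    using locally_constant_on_interval[OF I f2_loc] by blast
  obtain w where w: "\<And>x. x \<in> I \<Longrightarrow> f x = w"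
    using constant_on_interval_if_square_constant[OF I(2,3) smooth_on_continuous_on[OF smf] f2] by blast
  have 1: "deriv (deriv D) x / D x = w\<^sup>2 / 2 - K" if "x \<in> I" for x
    using w[OF that] K[OF that] by (simp add: f_def \<kappa>_def)
  have 2: "deriv H x / D x = 2 * (w / 2)" if "x \<in> I" for x
    using w[OF that] by (simp add: f_def)
  show ?thesis
    by (intro conjI exI[of _ "w / 2"] exI[of _ "w\<^sup>2 / 2 - K"] exI[of _ S0] ballI 1 2 S0)
qed

theorem theorem1:
  fixes H D S :: "real \<Rightarrow> real" and I J :: "real set"
  assumes "open I" and "is_interval I" and "I \<noteq> {}"
    and "open J" and "is_interval J" and "J \<noteq> {}"
    and "smooth_on I H" and "smooth_on I D" and "smooth_on J S"
    and "\<And>x. x \<in> I \<Longrightarrow> D x \<noteq> 0"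
  shows "locally_homogeneous (goedel_domain I J) (goedel_metric H D) (goedel_torsion D S) \<longleftrightarrow>
    (\<exists>\<omega>::real. \<forall>x\<in>I. deriv H x / D x = 2 * \<omega>) \<and>
    (\<exists>m2::real. \<forall>x\<in>I. deriv (deriv D) x / D x = m2) \<and>
    (\<exists>S0::real. \<forall>z\<in>J. S z = S0)"
proof
  assume hom: "locally_homogeneous (goedel_domain I J) (goedel_metric H D) (goedel_torsion D S)"
  show "(\<exists>\<omega>::real. \<forall>x\<in>I. deriv H x / D x = 2 * \<omega>) \<and>
    (\<exists>m2::real. \<forall>x\<in>I. deriv (deriv D) x / D x = m2) \<and>
    (\<exists>S0::real. \<forall>z\<in>J. S z = S0)"
    by (rule goedel_locally_homogeneous_imp_constant[OF assms(1-9) _ hom]) (rule assms(10))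
next
  assume "(\<exists>\<omega>::real. \<forall>x\<in>I. deriv H x / D x = 2 * \<omega>) \<and>
    (\<exists>m2::real. \<forall>x\<in>I. deriv (deriv D) x / D x = m2) \<and>
    (\<exists>S0::real. \<forall>z\<in>J. S z = S0)"
  then obtain \<omega> m2 S\<^sub>0 where const: "\<And>x. x \<in> I \<Longrightarrow> deriv H x / D x = 2 * \<omega>"
    "\<And>x. x \<in> I \<Longrightarrow> deriv (deriv D) x / D x = m2" "\<And>z. z \<in> J \<Longrightarrow> S z = S\<^sub>0"
    by blast
  \<comment> \<open>The model curvature is k = -m^2; the double negation matches the form of the
    chart hypothesis.\<close>
  have "deriv H x = 2 * \<omega> * D x" "deriv (deriv D) x = - (- m2) * D x" if "x \<in> I" for x
    using const(1,2)[OF that] assms(10)[OF that] by (simp_all add: field_simps)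
  note chart = goedel_standard_chart[OF assms(1,4,7,8,10) this const(3)]
  show "locally_homogeneous (goedel_domain I J) (goedel_metric H D) (goedel_torsion D S)"
  proof (rule locally_homogeneous_if_standard_charts)
    have "goedel_domain I J = (\<lambda>p. p $ 2) -` I \<inter> (\<lambda>p. p $ 4) -` J" by (auto simp: goedel_domain_def)
    then show "open (goedel_domain I J)"
      by (simp only:) (intro open_Int open_vimage assms(1,4) continuous_on_component continuous_on_id)
    show "\<exists>U F. standard_chart (goedel_domain I J) (goedel_metric H D) (goedel_torsion D S)
      (model_metric (- m2) \<omega>) (model_torsion (- m2) S\<^sub>0) p U F" if "p \<in> goedel_domain I J" for p
      by (rule chart[OF _ _ _ _ that])
  qed
qed

end
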